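(* Let $\lambda\ge 0$ and $a,a_\lambda>0$ be constants with $\mathbb{P}(M\le a\mid\mathbf{x})=\mathbb{P}(M_\lambda\le a_\lambda\mid\mathbf{x})$. Suppose $D\sim\mathcal{N}(0,\mathbf{\Sigma})$ (conditionally on the fixed covariates $\mathbf{x}$), $N_T=N_C$, $E$ is independent of $D$ (conditionally on $\mathbf{x}$), and the treatment effect is additive, so that $\hat\tau=\tau+\boldsymbol{\beta}^\top D+E$. Then the difference in variances of $\hat\tau$ between rerandomization and ridge rerandomization is $$\mathrm{Var}(\hat\tau\mid\mathbf{x},M\le a)-\mathrm{Var}(\hat\tau\mid\mathbf{x},M_\lambda\le a_\lambda)=\boldsymbol{\beta}^\top\mathbf{\Gamma}\,\mathbf{Diag}\big((\lambda_k(v_a-d_{k,\lambda}))_{1\le k\le K}\big)\,\mathbf{\Gamma}^\top\boldsymbol{\beta},$$ where $v_a = \mathbb{P}(\chi^2_{K+2}\le a)/\mathbb{P}(\chi^2_K\le a)$.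
   Context: $\mathbf{x}$ is a fixed real $N\times K$ covariate matrix on $N$ units, of which $N_T$ are assigned to treatment and $N_C=N-N_T$ to control ($N_T,N_C\ge1$), with assignment indicators $W_i\in\{0,1\}$, $\mathbf{W}=(W_1,\dots,W_N)^\top$. $\mathbf{\Sigma} = \frac{N}{N_T N_C} S^2_{\mathbf{x}}$ is assumed positive definite, where $S^2_{\mathbf{x}} = (N-1)^{-1}(\mathbf{x}-\mathbf{1}_N\bar{\mathbf{x}}_N)^\top(\mathbf{x}-\mathbf{1}_N\bar{\mathbf{x}}_N)$ and $\bar{\mathbf{x}}_N = N^{-1}\mathbf{1}_N^\top\mathbf{x}$ ($\mathbf{1}_N$ is the all-ones column vector). Spectral decomposition: $\mathbf{\Sigma}=\mathbf{\Gamma}\,\mathbf{Diag}(\lambda_1,\dots,\lambda_K)\,\mathbf{\Gamma}^\top$ with $\mathbf{\Gamma}$ orthogonal and $\lambda_1\ge\dots\ge\lambda_K>0$. Additive treatment effect: the fixed potential outcomes satisfy $Y_i(w)=\beta_0+\mathbf{x}_{i\bullet}\boldsymbol{\beta}+\tau w+\epsilon_i$ for $w\in\{0,1\}$ and all $i$, where $\mathbf{x}_{i\bullet}$ is the $i$-th row of $\mathbf{x}$, $\tau\in\mathbb{R}$, and $\beta_0\mathbf{1}_N+\mathbf{x}\boldsymbol{\beta}$ is the orthogonal projection of $(Y_1(0),\dots,Y_N(0))^\top$ onto the span of $\mathbf{1}_N$ and the columns of $\mathbf{x}$, with residual $\boldsymbol{\epsilon}=(\epsilon_1,\dots,\epsilon_N)^\top$.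 The estimator $\hat\tau$ is the treated mean minus the control mean of the observed outcomes $Y_i(W_i)$; hence $\hat\tau=\tau+\boldsymbol{\beta}^\top(\bar{\mathbf{x}}_T-\bar{\mathbf{x}}_C)+(\bar{\boldsymbol{\epsilon}}_T-\bar{\boldsymbol{\epsilon}}_C)$, where $\bar{\mathbf{x}}_T = N_T^{-1}\mathbf{x}^\top\mathbf{W}$, $\bar{\mathbf{x}}_C=N_C^{-1}\mathbf{x}^\top(\mathbf{1}_N-\mathbf{W})$, $\bar{\boldsymbol{\epsilon}}_T = N_T^{-1}\mathbf{W}^\top\boldsymbol{\epsilon}$, $\bar{\boldsymbol{\epsilon}}_C=N_C^{-1}(\mathbf{1}_N-\mathbf{W})^\top\boldsymbol{\epsilon}$. $D$ (a random vector in $\mathbb{R}^K$) and $E$ (a real random variable with finite variance) represent $\bar{\mathbf{x}}_T-\bar{\mathbf{x}}_C$ and $\bar{\boldsymbol{\epsilon}}_T-\bar{\boldsymbol{\epsilon}}_C$ respectively; the Normality and independence assumptions are idealizations imposed on their joint law, and $\hat\tau=\tau+\boldsymbol{\beta}^\top D+E$. The Mahalanobis distance is $M=D^\top\mathbf{\Sigma}^{-1}D$ and the ridge Mahalanobis distance is $M_\lambda = D^\top(\mathbf{\Sigma}+\lambda\mathbf{I}_K)^{-1}D$. Rerandomization means conditioning on the event $\{M\le a\}$; ridge rerandomization means conditioning on $\{M_\lambda\le a_\lambda\}$. For $k=1,\dots,K$, $d_{k,\lambda} = \mathbb{E}\big[Z_k^2 \,\big|\, \sum_{j=1}^K\frac{\lambda_j}{\lambda_j+\lambda}Z_j^2\le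 a_\lambda\big]$ with $Z_1,\dots,Z_K$ i.i.d. $\mathcal{N}(0,1)$. $\chi^2_m$ denotes a chi-squared random variable with $m$ degrees of freedom. *)

theory Defs
  imports "HOL-Probability.Probability"
begin

text \<open>
  The event \<open>A\<close> must have positive probability for these to be meaningful.  For a
  probability measure \<open>P\<close>, \<open>uniform_measure P A\<close> is the conditional law
  \<open>B \<mapsto> P (A \<inter> B) / P A\<close>.
\<close>

definition event_expectation :: "'a measure \<Rightarrow> 'a set \<Rightarrow> ('a \<Rightarrow> real) \<Rightarrow> real" where
  "event_expectation P A X = integral\<^sup>L (uniform_measure P A) X"

definition event_variance :: "'a measure \<Rightarrow> 'a set \<Rightarrow> ('a \<Rightarrow> real) \<Rightarrow> real" where
  "event_variance P A X =
     event_expectation P A (\<lambda>\<omega>. (X \<omega> - event_expectation P A X)\<^sup>2)"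

text \<open>
  \<open>prob_space.indep_var\<close> forces both variables to have the same value type; this is its
  unfolding (\<open>prob_space.indep_var_eq\<close>) for Borel variables of different types.
\<close>

definition indep_borel ::
    "'a measure \<Rightarrow> ('a \<Rightarrow> 'b::topological_space) \<Rightarrow> ('a \<Rightarrow> 'c::topological_space) \<Rightarrow> bool" where
  "indep_borel P X Y \<longleftrightarrow>
     X \<in> borel_measurable P \<and> Y \<in> borel_measurable P \<and>
     prob_space.indep_set P
       (sigma_sets (space P) {X -` A \<inter> space P | A. A \<in> sets borel})
       (sigma_sets (space P) {Y -` A \<inter> space P | A. A \<in> sets borel})"

definition pos_def :: "real^'k^'k \<Rightarrow> bool" where
  "pos_def A \<longleftrightarrow> transpose A = A \<and> (\<forall>v. v \<noteq> 0 \<longrightarrow> v \<bullet> (A *v v) > 0)"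

text \<open>Only used for positive definite \<open>S\<close>, where the law has this density.\<close>

definition mvn_density :: "real^'k \<Rightarrow> real^'k^'k \<Rightarrow> real^'k \<Rightarrow> real" where
  "mvn_density \<mu> S y =
     exp (- ((y - \<mu>) \<bullet> (matrix_inv S *v (y - \<mu>))) / 2) / sqrt ((2 * pi) ^ CARD('k) * det S)"

definition std_normal :: "real measure" where
  "std_normal = density lborel std_normal_density"

text \<open>The coordinates \<open>\<lambda>z. z i\<close>, \<open>i \<in> I\<close>, are i.i.d. standard normal under this measure.\<close>

definition iid_normal :: "'i set \<Rightarrow> ('i \<Rightarrow> real) measure" where
  "iid_normal I = Pi\<^sub>M I (\<lambda>_. std_normal)"

definition chi_squared :: "nat \<Rightarrow> real measure" where
  "chi_squared m = distr (iid_normal {..<m}) borel (\<lambda>z. \<Sum>i<m. (z i)\<^sup>2)"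

text \<open>
  Units are indexed by a finite type \<open>'n\<close> and covariates by a finite type \<open>'k\<close>, so
  \<open>N = CARD('n)\<close>, \<open>K = CARD('k)\<close>, and \<open>x $ i\<close> is the covariate row of unit \<open>i\<close>.
\<close>

definition col_means :: "real^'k^'n \<Rightarrow> real^'k" where
  "col_means x = (1 / real CARD('n)) *\<^sub>R (vec 1 v* x)"

definition centered :: "real^'k^'n \<Rightarrow> real^'k^'n" where
  "centered x = (\<chi> i. x $ i - col_means x)"

definition sample_cov :: "real^'k^'n \<Rightarrow> real^'k^'k" where
  "sample_cov x =
     (1 / (real CARD('n) - 1)) *\<^sub>R (transpose (centered x) ** centered x)"

text \<open>\<open>\<Sigma>\<close>: the covariance matrix of the covariate mean difference, for group sizes \<open>nT\<close>, \<open>nC\<close>.\<close>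

definition diff_cov :: "real^'k^'n \<Rightarrow> nat \<Rightarrow> nat \<Rightarrow> real^'k^'k" where
  "diff_cov x nT nC = (real CARD('n) / (real nT * real nC)) *\<^sub>R sample_cov x"

definition is_orth_projection :: "('a::euclidean_space) set \<Rightarrow> 'a \<Rightarrow> 'a \<Rightarrow> bool" where
  "is_orth_projection S y p \<longleftrightarrow> p \<in> S \<and> (\<forall>v\<in>S. orthogonal (y - p) v)"

text \<open>
  \<open>Y i w\<close> is the potential outcome of unit \<open>i\<close> under treatment (\<open>w = True\<close>) or
  control (\<open>w = False\<close>).
\<close>

definition additive_effect ::
    "real^'k^'n \<Rightarrow> ('n \<Rightarrow> bool \<Rightarrow> real) \<Rightarrow> real \<Rightarrow> real^'k \<Rightarrow> real \<Rightarrow> real^'n \<Rightarrow> bool" where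
  "additive_effect x Y \<beta>\<^sub>0 \<beta> \<tau> \<epsilon> \<longleftrightarrow>
     (\<forall>i w. Y i w = \<beta>\<^sub>0 + x $ i \<bullet> \<beta> + \<tau> * of_bool w + \<epsilon> $ i) \<and>
     is_orth_projection (span (insert (vec 1) (columns x)))
       (\<chi> i. Y i False) (\<beta>\<^sub>0 *\<^sub>R vec 1 + x *v \<beta>)"

definition mean_diff :: "('n::finite \<Rightarrow> bool) \<Rightarrow> ('n \<Rightarrow> 'v::real_vector) \<Rightarrow> 'v" where
  "mean_diff W f =
     (1 / real (card {i. W i})) *\<^sub>R (\<Sum>i | W i. f i)
     - (1 / real (card {i. \<not> W i})) *\<^sub>R (\<Sum>i | \<not> W i. f i)"

text \<open>
  The exact decomposition of the difference-in-means estimator for an assignment \<open>W\<close>.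
  Replacing the two (finitely supported) mean differences on the right by idealised random
  variables \<open>D\<close> and \<open>E\<close> gives the estimator \<open>\<tau> + \<beta> \<bullet> D + E\<close>.
\<close>

lemma mean_diff_observed:
  assumes add: "additive_effect x Y \<beta>\<^sub>0 \<beta> \<tau> \<epsilon>" and T: "\<exists>i. W i" and C: "\<exists>i. \<not> W i"
  shows "mean_diff W (\<lambda>i. Y i (W i)) =
    \<tau> + \<beta> \<bullet> mean_diff W (\<lambda>i. x $ i) + mean_diff W (\<lambda>i. \<epsilon> $ i)"
proof -
  have Y: "Y i w = \<beta>\<^sub>0 + \<beta> \<bullet> x $ i + \<tau> * of_bool w + \<epsilon> $ i" for i w
    using add by (simp add: additive_effect_def inner_commute)
  have "card {i. W i} \<noteq> 0" "card {i. \<not> W i} \<noteq> 0"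
    using T C by auto
  then show ?thesis
    unfolding mean_diff_def Y
    by (simp add: sum.distrib inner_diff_right inner_sum_right field_simps)
qed

definition mahalanobis :: "real^'k^'k \<Rightarrow> real^'k \<Rightarrow> real" where
  "mahalanobis S y = y \<bullet> (matrix_inv S *v y)"

definition ridge_mahalanobis :: "real \<Rightarrow> real^'k^'k \<Rightarrow> real^'k \<Rightarrow> real" where
  "ridge_mahalanobis l S y = y \<bullet> (matrix_inv (S + l *\<^sub>R mat 1) *v y)"

definition diag_mat :: "('k \<Rightarrow> real) \<Rightarrow> real^'k^'k" where
  "diag_mat f = (\<chi> i j. if i = j then f i else 0)"

text \<open>\<open>lam\<close> are the eigenvalues \<open>\<lambda>\<^sub>k\<close> of \<open>\<Sigma>\<close> and \<open>l\<close> is the ridge parameter \<open>\<lambda>\<close>.\<close>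

definition ridge_d :: "('k::finite \<Rightarrow> real) \<Rightarrow> real \<Rightarrow> real \<Rightarrow> 'k \<Rightarrow> real" where
  "ridge_d lam l al k =
     event_expectation (iid_normal UNIV)
       {z \<in> space (iid_normal UNIV). (\<Sum>j\<in>UNIV. lam j / (lam j + l) * (z j)\<^sup>2) \<le> al}
       (\<lambda>z. (z k)\<^sup>2)"

definition maha_v :: "nat \<Rightarrow> real \<Rightarrow> real" where
  "maha_v K a = measure (chi_squared (K + 2)) {..a} / measure (chi_squared K) {..a}"

end

theory Submission
  imports Defs
begin

text \<open>
  In the coordinates \<open>Z = \<Lambda>\<^sup>-\<^sup>1\<^sup>/\<^sup>2 \<Gamma>\<^sup>T D\<close> the vector \<open>D\<close> becomes i.i.d. standard normal, and both
  conditioning events take the form \<open>\<Sum> c\<^sub>j Z\<^sub>j\<^sup>2 \<le> t\<close>, the Mahalanobis distance being the ridge distance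
  with parameter \<open>0\<close>.  Such events are invariant under sign changes of single coordinates, so all
  conditional means and cross moments of \<open>Z\<close> vanish, and independence of \<open>E\<close> makes its variance
  contribute equally to both sides.  What remains is
  \<open>\<Sum>\<^sub>k \<lambda>\<^sub>k (\<Gamma>\<^sup>T \<beta>)\<^sub>k\<^sup>2 E[Z\<^sub>k\<^sup>2 | event]\<close>.  Finally
  \<open>E[Z\<^sub>k\<^sup>2; \<Sum> Z\<^sub>j\<^sup>2 \<le> a] = P(\<chi>\<^sup>2\<^bsub>K+2\<^esub> \<le> a)\<close>: conditioning on the other coordinates reduces this to
  \<open>E[Z\<^sup>2; Z\<^sup>2 \<le> t] = P(\<chi>\<^sup>2\<^sub>3 \<le> t)\<close>.
\<close>

subsection \<open>Standard normal product measures and truncated second moments\<close>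

lemma sets_std_normal [simp, measurable_cong]: "sets std_normal = sets borel"
  by (simp add: std_normal_def)

lemma space_std_normal [simp]: "space std_normal = UNIV"
  by (simp add: std_normal_def)

lemma prob_space_std_normal: "prob_space std_normal"
  unfolding std_normal_def by (rule prob_space_normal_density) simp

lemma product_sigma_finite_std_normal: "product_sigma_finite (\<lambda>_. std_normal)"
  by unfold_locales
    (metis prob_space_std_normal prob_space_imp_sigma_finite sigma_finite_measure.sigma_finite_countable)

lemma sets_iid_normal [measurable_cong]: "sets (iid_normal I) = sets (Pi\<^sub>M I (\<lambda>_. borel))"
  unfolding iid_normal_def by (intro sets_PiM_cong) simp_all

lemma space_iid_normal: "space (iid_normal I) = Pi\<^sub>E I (\<lambda>_. UNIV)"
  by (simp add: iid_normal_def space_PiM)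

lemma prob_space_iid_normal: "prob_space (iid_normal I)"
  unfolding iid_normal_def by (intro prob_space_PiM prob_space_std_normal)

text \<open>Product measures are determined by boxes, and on a box the integral of the product
  density factors. The Lebesgue form is what the layer-cake computation and the linear change of
  variables work with.\<close>

lemma iid_normal_eq_density:
  assumes I: "finite I"
  shows "iid_normal I =
    density (Pi\<^sub>M I (\<lambda>_. lborel)) (\<lambda>z. \<Prod>i\<in>I. ennreal (std_normal_density (z i)))"
proof -
  interpret N: product_sigma_finite "\<lambda>_. std_normal"
    by (rule product_sigma_finite_std_normal)
  interpret L: product_sigma_finite "\<lambda>_. lborel :: real measure" ..
  show ?thesis
    unfolding iid_normal_def
  proof (rule N.PiM_eqI[OF I, symmetric])
    show "sets (density (Pi\<^sub>M I (\<lambda>_. lborel)) (\<lambda>z. \<Prod>i\<in>I. ennreal (std_normal_density (z i))))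
        = sets (Pi\<^sub>M I (\<lambda>_. std_normal))"
      by (simp cong: sets_PiM_cong)
    fix A assume A: "\<And>i. i \<in> I \<Longrightarrow> A i \<in> sets std_normal"
    have "emeasure (density (Pi\<^sub>M I (\<lambda>_. lborel)) (\<lambda>z. \<Prod>i\<in>I. ennreal (std_normal_density (z i))))
        (Pi\<^sub>E I A) = (\<integral>\<^sup>+z. (\<Prod>i\<in>I. ennreal (std_normal_density (z i))) * indicator (Pi\<^sub>E I A) z
          \<partial>Pi\<^sub>M I (\<lambda>_. lborel))"
      using A I by (intro emeasure_density sets_PiM_I_finite) auto
    also have "\<dots> = (\<integral>\<^sup>+z. (\<Prod>i\<in>I. ennreal (std_normal_density (z i)) * indicator (A i) (z i))
          \<partial>Pi\<^sub>M I (\<lambda>_. lborel))"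
    proof (intro nn_integral_cong)
      fix z :: "'a \<Rightarrow> real" assume "z \<in> space (Pi\<^sub>M I (\<lambda>_. lborel))"
      then have "indicator (Pi\<^sub>E I A) z = (\<Prod>i\<in>I. indicator (A i) (z i) :: ennreal)"
        using I by (auto simp: indicator_def space_PiM PiE_iff)
      then show "(\<Prod>i\<in>I. ennreal (std_normal_density (z i))) * indicator (Pi\<^sub>E I A) z
          = (\<Prod>i\<in>I. ennreal (std_normal_density (z i)) * indicator (A i) (z i))"
        by (simp add: prod.distrib)
    qed
    also have "\<dots> = (\<Prod>i\<in>I. \<integral>\<^sup>+x. ennreal (std_normal_density x) * indicator (A i) x \<partial>lborel)"
      using A by (intro L.product_nn_integral_prod[OF I]) auto
    also have "\<dots> = (\<Prod>i\<in>I. emeasure std_normal (A i))"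
      using A by (intro prod.cong refl) (auto simp: std_normal_def emeasure_density)
    finally show "emeasure (density (Pi\<^sub>M I (\<lambda>_. lborel))
        (\<lambda>z. \<Prod>i\<in>I. ennreal (std_normal_density (z i)))) (Pi\<^sub>E I A)
        = (\<Prod>i\<in>I. emeasure std_normal (A i))" .
  qed
qed

lemma prod_std_normal_density:
  assumes "finite I"
  shows "(\<Prod>i\<in>I. std_normal_density (z i))
    = (1 / sqrt (2 * pi)) ^ card I * exp (- (\<Sum>i\<in>I. (z i)\<^sup>2) / 2)"
  using assms
  by (simp add: std_normal_density_def prod.distrib exp_sum[symmetric] sum_negf sum_divide_distrib
      power_one_over prod_dividef)

text \<open>Product measures are invariant under bijective reindexing, here by an enumeration
  \<open>h\<close> of \<open>I\<close>. This frees \<open>chi_squared\<close> from the index set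
  \<open>{..<m}\<close> of its definition.\<close>

lemma distr_iid_normal_eq_chi_squared:
  assumes I: "finite I"
  shows "distr (iid_normal I) borel (\<lambda>z. \<Sum>i\<in>I. (z i)\<^sup>2) = chi_squared (card I)"
proof -
  obtain h where h: "bij_betw h {..<card I} I"
    using ex_bij_betw_nat_finite[OF I] by (auto simp: atLeast0LessThan)
  have "distr (iid_normal I) (iid_normal {..<card I}) (\<lambda>z. \<lambda>n\<in>{..<card I}. z (h n))
      = iid_normal {..<card I}"
    unfolding iid_normal_def using h
    by (intro distr_PiM_reindex prob_space_std_normal) (auto simp: bij_betw_def)
  then have "chi_squared (card I) =
      distr (distr (iid_normal I) (iid_normal {..<card I}) (\<lambda>z. \<lambda>n\<in>{..<card I}. z (h n)))
        borel (\<lambda>z. \<Sum>i<card I. (z i)\<^sup>2)"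
    by (simp add: chi_squared_def)
  also have "\<dots> = distr (iid_normal I) borel (\<lambda>z. \<Sum>i<card I. (z (h i))\<^sup>2)"
  proof (subst distr_distr)
    show "(\<lambda>z. \<lambda>n\<in>{..<card I}. z (h n)) \<in> iid_normal I \<rightarrow>\<^sub>M iid_normal {..<card I}"
      unfolding iid_normal_def using h
      by (intro measurable_restrict measurable_component_singleton) (auto simp: bij_betw_def)
  qed (auto intro!: distr_cong)
  also have "(\<lambda>z. \<Sum>i<card I. (z (h i))\<^sup>2) = (\<lambda>z. \<Sum>i\<in>I. (z i)\<^sup>2 :: real)"
    using sum.reindex_bij_betw[OF h] by fast
  finally show ?thesis ..
qed

lemma nn_integral_chi_squared:
  assumes "finite I" "g \<in> borel_measurable borel"
  shows "(\<integral>\<^sup>+z. g (\<Sum>i\<in>I. (z i)\<^sup>2) \<partial>iid_normal I) = (\<integral>\<^sup>+s. g s \<partial>chi_squared (card I))"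
  unfolding distr_iid_normal_eq_chi_squared[OF assms(1), symmetric]
  using assms by (subst nn_integral_distr) auto

text \<open>Write \<open>exp (- q z / 2)\<close> as the integral of \<open>exp (- v / 2) / 2\<close>
  over \<open>v \<ge> q z\<close> and swap the integrals by Tonelli. The bounds
  \<open>q z \<le> t\<close> and \<open>q z \<le> v\<close> merge into one bound by
  \<open>min t v\<close>, so a truncated Gaussian integral becomes a weighted integral of ones
  without the exponential.\<close>

lemma layer_cake_exp:
  fixes q :: "'a \<Rightarrow> real" and f :: "'a \<Rightarrow> ennreal"
  assumes "sigma_finite_measure M"
  assumes [measurable]: "f \<in> borel_measurable M" "q \<in> borel_measurable M"
    and q: "\<And>z. z \<in> space M \<Longrightarrow> 0 \<le> q z"
  shows "(\<integral>\<^sup>+z. f z * ennreal (exp (- q z / 2)) * indicator {z. q z \<le> t} z \<partial>M) =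
    (\<integral>\<^sup>+v. ennreal (exp (- v / 2) / 2) * indicator {0<..} v *
      (\<integral>\<^sup>+z. f z * indicator {z. q z \<le> min t v} z \<partial>M) \<partial>lborel)"
proof -
  interpret M: sigma_finite_measure M by fact
  interpret pair_sigma_finite M "lborel :: real measure" ..
  have tail: "(\<integral>\<^sup>+v. ennreal (exp (- v / 2) / 2) * indicator {0<..} v * indicator {c..} v \<partial>lborel)
      = ennreal (exp (- c / 2))" if "0 \<le> c" for c :: real
  proof -
    \<comment> \<open>As \<open>c \<ge> 0\<close>, the restriction to \<open>v > 0\<close> alters
      the integrand at most at the single point \<open>0\<close>.\<close>
    have "(\<integral>\<^sup>+v. ennreal (exp (- v / 2) / 2) * indicator {0<..} v * indicator {c..} v \<partial>lborel)
        = (\<integral>\<^sup>+v. ennreal (exp (- v / 2) / 2) * indicator {c..} v \<partial>lborel)"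
      using that AE_lborel_singleton[of 0]
      by (intro nn_integral_cong_AE) (auto simp: indicator_def elim!: eventually_mono)
    also have "\<dots> = ennreal (0 - (- exp (- c / 2)))"
    proof (rule nn_integral_FTC_atLeast)
      show "((\<lambda>v. - exp (- v / 2)) \<longlongrightarrow> (0 :: real)) at_top"
        by real_asymp
    qed (auto intro!: derivative_eq_intros)
    finally show ?thesis by simp
  qed
  have "(\<integral>\<^sup>+z. f z * ennreal (exp (- q z / 2)) * indicator {z. q z \<le> t} z \<partial>M) =
      (\<integral>\<^sup>+z. (\<integral>\<^sup>+v. ennreal (exp (- v / 2) / 2) * indicator {0<..} v *
        (f z * indicator {z. q z \<le> min t v} z) \<partial>lborel) \<partial>M)"
  proof (rule nn_integral_cong)
    fix z assume z: "z \<in> space M"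
    have "f z * ennreal (exp (- q z / 2)) * indicator {z. q z \<le> t} z =
        f z * indicator {z. q z \<le> t} z *
        (\<integral>\<^sup>+v. ennreal (exp (- v / 2) / 2) * indicator {0<..} v * indicator {q z..} v \<partial>lborel)"
      unfolding tail[OF q[OF z]] by (simp add: mult_ac)
    also have "\<dots> = (\<integral>\<^sup>+v. f z * indicator {z. q z \<le> t} z *
        (ennreal (exp (- v / 2) / 2) * indicator {0<..} v * indicator {q z..} v) \<partial>lborel)"
      by (rule nn_integral_cmult[symmetric]) measurable
    also have "\<dots> = (\<integral>\<^sup>+v. ennreal (exp (- v / 2) / 2) * indicator {0<..} v *
        (f z * indicator {z. q z \<le> min t v} z) \<partial>lborel)"
      by (intro nn_integral_cong) (auto simp: indicator_def mult_ac)
    finally show "f z * ennreal (exp (- q z / 2)) * indicator {z. q z \<le> t} z =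
        (\<integral>\<^sup>+v. ennreal (exp (- v / 2) / 2) * indicator {0<..} v *
        (f z * indicator {z. q z \<le> min t v} z) \<partial>lborel)" .
  qed
  also have "\<dots> = (\<integral>\<^sup>+v. (\<integral>\<^sup>+z. ennreal (exp (- v / 2) / 2) * indicator {0<..} v *
        (f z * indicator {z. q z \<le> min t v} z) \<partial>M) \<partial>lborel)"
    by (rule Fubini'[symmetric]) (simp add: indicator_def)
  also have "\<dots> = (\<integral>\<^sup>+v. ennreal (exp (- v / 2) / 2) * indicator {0<..} v *
      (\<integral>\<^sup>+z. f z * indicator {z. q z \<le> min t v} z \<partial>M) \<partial>lborel)"
    by (intro nn_integral_cong nn_integral_cmult) measurable
  finally show ?thesis .
qed

section \<open>Ball volumes and truncated second moments\<close>

lemma emeasure_Collect_eq_nn_integral: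
  assumes [measurable]: "Measurable.pred M Q"
  shows "emeasure M {x \<in> space M. Q x} = (\<integral>\<^sup>+x. indicator {x. Q x} x \<partial>M)"
proof -
  have "emeasure M {x \<in> space M. Q x} = (\<integral>\<^sup>+x. indicator {x \<in> space M. Q x} x \<partial>M)"
    by simp
  also have "\<dots> = (\<integral>\<^sup>+x. indicator {x. Q x} x \<partial>M)"
    by (intro nn_integral_cong) (simp add: indicator_def)
  finally show ?thesis .
qed

text \<open>\<open>max 0 s\<close> lets the formula cover empty balls, which occur in the layer-cake
  integral for negative thresholds. A nonempty \<open>I\<close> is what makes the right side vanish
  there, since a zeroth power would be \<open>1\<close>.\<close>

lemma emeasure_PiM_cball:
  assumes I: "finite I" "I \<noteq> {}"
  shows "emeasure (Pi\<^sub>M I (\<lambda>_. lborel)) {z \<in> space (Pi\<^sub>M I (\<lambda>_. lborel)). (\<Sum>i\<in>I. (z i)\<^sup>2) \<le> s}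
    = ennreal (unit_ball_vol (card I) * sqrt (max 0 s) ^ card I)"
proof -
  interpret L: product_sigma_finite "\<lambda>_. lborel :: real measure" ..
  consider "s < 0" | "s = 0" | "s > 0" by linarith
  then show ?thesis
  proof cases
    case 1
    then have "{z \<in> space (Pi\<^sub>M I (\<lambda>_. lborel)). (\<Sum>i\<in>I. (z i)\<^sup>2) \<le> s} = {}"
      by (auto simp: not_le intro!: less_le_trans[OF _ sum_nonneg])
    with 1 I show ?thesis by (simp only: emeasure_empty) (simp add: card_gt_0_iff)
  next
    \<comment> \<open>Radius zero leaves only the origin, a null set, so the ball formula has to be
      invoked for positive radius only.\<close>
    case 2
    then have "{z \<in> space (Pi\<^sub>M I (\<lambda>_. lborel)). (\<Sum>i\<in>I. (z i)\<^sup>2) \<le> s} = Pi\<^sub>E I (\<lambda>_. {0 :: real})"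
      using I by (auto simp: space_PiM PiE_iff antisym_conv[OF sum_nonneg] sum_nonneg_eq_0_iff
          extensional_def fun_eq_iff)
    with 2 I show ?thesis
      using L.emeasure_PiM[OF I(1), of "\<lambda>_. {0}"] by (simp add: power_0_left)
  next
    case 3
    then have "{z \<in> space (Pi\<^sub>M I (\<lambda>_. lborel)). (\<Sum>i\<in>I. (z i)\<^sup>2) \<le> s}
        = {z. sqrt (\<Sum>i\<in>I. (z i)\<^sup>2) \<le> sqrt s} \<inter> space (Pi\<^sub>M I (\<lambda>_. lborel))"
      by auto
    with 3 I emeasure_cball_aux[OF I(1), of "sqrt s"] show ?thesis by simp
  qed
qed

text \<open>With antiderivative \<open>x ^ 3 / 3\<close> the result grows with the third power of
  \<open>sqrt s\<close>, like the volume of a three-dimensional ball.\<close>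

lemma nn_integral_square_truncated:
  "(\<integral>\<^sup>+x. ennreal (x\<^sup>2) * indicator {x. x\<^sup>2 \<le> s} x \<partial>lborel) = ennreal (2 / 3 * sqrt (max 0 s) ^ 3)"
proof (cases "0 \<le> s")
  case True
  then have "{x. x\<^sup>2 \<le> s} = {- sqrt s..sqrt s}"
    by (auto simp: abs_le_iff real_sqrt_le_iff[symmetric, of "_\<^sup>2"] simp del: real_sqrt_le_iff)
  moreover have "(\<integral>\<^sup>+x. ennreal (x\<^sup>2) * indicator {- sqrt s..sqrt s} x \<partial>lborel)
      = ennreal ((sqrt s) ^ 3 / 3 - (- sqrt s) ^ 3 / 3)"
    using True
    by (intro nn_integral_FTC_Icc[where F="\<lambda>x. x ^ 3 / 3"])
      (auto intro!: derivative_eq_intros)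
  ultimately show ?thesis using True by simp
next
  case False
  then have "{x. x\<^sup>2 \<le> s} = {}"
    by (auto simp: not_le intro: less_le_trans)
  with False show ?thesis by simp
qed

text \<open>
  In layer-cake form both sides compare \<open>\<integral> x\<^sup>2\<close> over an interval with the volume of a
  three-dimensional ball, and these are proportional.
\<close>

lemma truncated_second_moment_std_normal:
  fixes J :: "'i set"
  assumes card: "card J = 3"
  shows "(\<integral>\<^sup>+x. ennreal (x\<^sup>2) * indicator {x. x\<^sup>2 \<le> t} x \<partial>std_normal)
    = emeasure (iid_normal J) {z \<in> space (iid_normal J). (\<Sum>i\<in>J. (z i)\<^sup>2) \<le> t}"
proof -
  have J: "finite J" "J \<noteq> {}"
    using card by (auto intro: card_ge_0_finite)
  interpret L: product_sigma_finite "\<lambda>_ :: 'i. lborel :: real measure" ..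
  let ?L = "Pi\<^sub>M J (\<lambda>_. lborel :: real measure)"
  let ?c = "1 / sqrt (2 * pi)"
  let ?w = "\<lambda>v :: real. ennreal (exp (- v / 2) / 2) * indicator {0<..} v"
  \<comment> \<open>The constants balance exactly: \<open>unit_ball_vol 3\<close> is
    \<open>4 / 3 * pi\<close>, and the two surplus factors \<open>?c\<close> contribute
    \<open>1 / (2 * pi)\<close>, leaving \<open>2 / 3\<close>.\<close>
  have const: "?c ^ 3 * (unit_ball_vol 3 * r) = ?c * (2 / 3 * r)" for r
  proof -
    have "?c ^ 3 = ?c * (1 / (2 * pi))"
      by (simp add: power3_eq_cube)
    then show ?thesis by (simp add: unit_ball_vol_3 del: power_one_over)
  qed
  have "(\<integral>\<^sup>+x. ennreal (x\<^sup>2) * indicator {x. x\<^sup>2 \<le> t} x \<partial>std_normal)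
      = (\<integral>\<^sup>+x. ennreal (std_normal_density x) * (ennreal (x\<^sup>2) * indicator {x. x\<^sup>2 \<le> t} x) \<partial>lborel)"
    unfolding std_normal_def by (intro nn_integral_density) (simp_all add: indicator_def)
  also have "\<dots> = (\<integral>\<^sup>+x. ennreal ?c * (ennreal (x\<^sup>2) * ennreal (exp (- x\<^sup>2 / 2)) * indicator {x. x\<^sup>2 \<le> t} x) \<partial>lborel)"
    unfolding std_normal_density_def
    by (intro nn_integral_cong) (subst ennreal_mult, simp_all add: mult_ac del: times_divide_eq_left)
  also have "\<dots> = ennreal ?c * (\<integral>\<^sup>+x. ennreal (x\<^sup>2) * ennreal (exp (- x\<^sup>2 / 2)) * indicator {x. x\<^sup>2 \<le> t} x \<partial>lborel)"
    by (intro nn_integral_cmult) (simp add: indicator_def)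
  also have "\<dots> = ennreal ?c * (\<integral>\<^sup>+v. ?w v * ennreal (2 / 3 * sqrt (max 0 (min t v)) ^ 3) \<partial>lborel)"
    by (subst layer_cake_exp) (simp_all add: nn_integral_square_truncated sigma_finite_lborel
        del: min.bounded_iff)
  also have "\<dots> = (\<integral>\<^sup>+v. ennreal ?c * (?w v * ennreal (2 / 3 * sqrt (max 0 (min t v)) ^ 3)) \<partial>lborel)"
    by (intro nn_integral_cmult[symmetric]) measurable
  also have "\<dots> = (\<integral>\<^sup>+v. ennreal (?c ^ 3) * (?w v * ennreal (unit_ball_vol 3 * sqrt (max 0 (min t v)) ^ 3)) \<partial>lborel)"
  proof (intro nn_integral_cong)
    fix v
    have "ennreal ?c * ennreal (2 / 3 * sqrt (max 0 (min t v)) ^ 3)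
        = ennreal (?c ^ 3) * ennreal (unit_ball_vol 3 * sqrt (max 0 (min t v)) ^ 3)"
      by (subst (1 2) ennreal_mult[symmetric]) (simp_all only: const, simp_all)
    then show "ennreal ?c * (?w v * ennreal (2 / 3 * sqrt (max 0 (min t v)) ^ 3))
        = ennreal (?c ^ 3) * (?w v * ennreal (unit_ball_vol 3 * sqrt (max 0 (min t v)) ^ 3))"
      by (metis mult.left_commute)
  qed
  also have "\<dots> = ennreal (?c ^ 3) * (\<integral>\<^sup>+v. ?w v * ennreal (unit_ball_vol 3 * sqrt (max 0 (min t v)) ^ 3) \<partial>lborel)"
    by (intro nn_integral_cmult) measurable
  also have "\<dots> = ennreal (?c ^ 3) * (\<integral>\<^sup>+v. ?w v * (\<integral>\<^sup>+z. 1 * indicator {z. (\<Sum>i\<in>J. (z i)\<^sup>2) \<le> min t v} z \<partial>?L) \<partial>lborel)"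
  proof -
    have "(\<integral>\<^sup>+z. 1 * indicator {z. (\<Sum>i\<in>J. (z i)\<^sup>2) \<le> s} z \<partial>?L)
        = emeasure ?L {z \<in> space ?L. (\<Sum>i\<in>J. (z i)\<^sup>2) \<le> s}" for s
      by (subst emeasure_Collect_eq_nn_integral) simp_all
    then show ?thesis by (simp add: emeasure_PiM_cball[OF J] card del: min.bounded_iff)
  qed
  \<comment> \<open>Layer cake read backwards in three dimensions, with \<open>f\<close> constantly
    \<open>1\<close>, puts the exponential back and so rebuilds the joint density on
    \<open>J\<close>.\<close>
  also have "\<dots> = ennreal (?c ^ 3) * (\<integral>\<^sup>+z. 1 * ennreal (exp (- (\<Sum>i\<in>J. (z i)\<^sup>2) / 2)) *
      indicator {z. (\<Sum>i\<in>J. (z i)\<^sup>2) \<le> t} z \<partial>?L)"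
    by (subst layer_cake_exp) (auto intro!: sum_nonneg L.sigma_finite J)
  also have "\<dots> = (\<integral>\<^sup>+z. ennreal (?c ^ 3) * (1 * ennreal (exp (- (\<Sum>i\<in>J. (z i)\<^sup>2) / 2)) *
      indicator {z. (\<Sum>i\<in>J. (z i)\<^sup>2) \<le> t} z) \<partial>?L)"
    by (intro nn_integral_cmult[symmetric]) (simp add: indicator_def)
  also have "\<dots> = (\<integral>\<^sup>+z. (\<Prod>i\<in>J. ennreal (std_normal_density (z i))) *
      indicator {z \<in> space ?L. (\<Sum>i\<in>J. (z i)\<^sup>2) \<le> t} z \<partial>?L)"
    by (intro nn_integral_cong)
      (simp add: prod_ennreal prod_std_normal_density J card indicator_def ennreal_mult')
  also have "\<dots> = emeasure (iid_normal J) {z \<in> space (iid_normal J). (\<Sum>i\<in>J. (z i)\<^sup>2) \<le> t}"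
    unfolding iid_normal_eq_density[OF J(1)] space_density
    by (intro emeasure_density[symmetric]) measurable
  finally show ?thesis .
qed

text \<open>Integrating out coordinate \<open>k\<close> first leaves a one-dimensional moment
  truncated at \<open>a\<close> minus the other squares. That moment is the probability that three
  fresh squares stay below the same bound, so one coordinate is traded for three and
  \<open>CARD('i) - 1 + 3\<close> degrees of freedom result.\<close>

lemma truncated_second_moment_iid_normal:
  fixes k :: "'i::finite"
  shows "(\<integral>\<^sup>+z. ennreal ((z k)\<^sup>2) * indicator {z. (\<Sum>i\<in>UNIV. (z i)\<^sup>2) \<le> a} z \<partial>iid_normal UNIV)
    = emeasure (chi_squared (CARD('i) + 2)) {..a}"
proof -
  let ?I = "UNIV - {k}"
  define m where "m = CARD('i) - 1"
  \<comment> \<open>The three fresh coordinates are numbered from \<open>m\<close> on, so that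
    together with \<open>{..<m}\<close> they form the initial segment on which
    \<open>chi_squared (m + 3)\<close> is defined.\<close>
  define J where "J = {m..<m + 3}"
  have J: "card J = 3" "finite J" "{..<m} \<inter> J = {}" "{..<m} \<union> J = {..<m + 3}"
    by (auto simp: J_def)
  define F where "F t = emeasure (iid_normal J) {z \<in> space (iid_normal J). (\<Sum>i\<in>J. (z i)\<^sup>2) \<le> t}" for t
  have m: "card ?I = m" "CARD('i) + 2 = m + 3"
    by (simp_all add: m_def card_Diff_singleton Suc_leI)
  interpret N: product_sigma_finite "\<lambda>_ :: 'i. std_normal"
    by (rule product_sigma_finite_std_normal)
  interpret N': product_sigma_finite "\<lambda>_ :: nat. std_normal"
    by (rule product_sigma_finite_std_normal)
  interpret S: sigma_finite_measure std_normal
    using prob_space_std_normal by (rule prob_space_imp_sigma_finite)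
  have F_eq: "F t = (\<integral>\<^sup>+x. ennreal (x\<^sup>2) * indicator {x. x\<^sup>2 \<le> t} x \<partial>std_normal)" for t
    unfolding F_def
    by (subst truncated_second_moment_std_normal[OF J(1)]) simp
  have [measurable]: "F \<in> borel_measurable borel"
    unfolding F_eq by (simp add: indicator_def)
  have "(\<integral>\<^sup>+z. ennreal ((z k)\<^sup>2) * indicator {z. (\<Sum>i\<in>UNIV. (z i)\<^sup>2) \<le> a} z \<partial>iid_normal UNIV)
      = (\<integral>\<^sup>+z. ennreal ((z k)\<^sup>2) * indicator {z. (\<Sum>i\<in>insert k ?I. (z i)\<^sup>2) \<le> a} z \<partial>iid_normal (insert k ?I))"
    by (simp add: insert_absorb)
  also have "\<dots> = (\<integral>\<^sup>+z. (\<integral>\<^sup>+x. ennreal (x\<^sup>2) * indicator {x. x\<^sup>2 \<le> a - (\<Sum>i\<in>?I. (z i)\<^sup>2)} x \<partial>std_normal) \<partial>iid_normal ?I)"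
    unfolding iid_normal_def
  proof (subst N.product_nn_integral_insert, goal_cases)
    case 4
    have "(\<Sum>i\<in>insert k ?I. ((z(k := x)) i)\<^sup>2) = x\<^sup>2 + (\<Sum>i\<in>?I. (z i)\<^sup>2)" for z :: "'i \<Rightarrow> real" and x
      by (subst sum.insert) auto
    then show ?case
      by (intro nn_integral_cong) (simp add: indicator_def algebra_simps)
  qed (simp_all add: indicator_def)
  also have "\<dots> = (\<integral>\<^sup>+z. F (a - (\<Sum>i\<in>?I. (z i)\<^sup>2)) \<partial>iid_normal ?I)"
    by (simp only: F_eq)
  \<comment> \<open>Passing through \<open>chi_squared m\<close> replaces the index set
    \<open>?I\<close> of type \<open>'i set\<close> by \<open>{..<m}\<close>; merging with
    \<open>J\<close> requires index sets over one type.\<close>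
  also have "\<dots> = (\<integral>\<^sup>+s. F (a - s) \<partial>chi_squared m)"
    by (subst nn_integral_chi_squared[where g="\<lambda>s. F (a - s)"]) (simp_all add: m)
  also have "\<dots> = (\<integral>\<^sup>+z. F (a - (\<Sum>i<m. (z i)\<^sup>2)) \<partial>iid_normal {..<m})"
    by (subst nn_integral_chi_squared[where g="\<lambda>s. F (a - s)"]) simp_all
  also have "\<dots> = (\<integral>\<^sup>+z. \<integral>\<^sup>+y. indicator {z. (\<Sum>i\<in>{..<m} \<union> J. (z i)\<^sup>2) \<le> a} (merge {..<m} J (z, y)) \<partial>iid_normal J \<partial>iid_normal {..<m})"
  proof (intro nn_integral_cong)
    fix z assume "z \<in> space (iid_normal {..<m})"
    have "(\<Sum>i\<in>{..<m} \<union> J. (merge {..<m} J (z, y) i)\<^sup>2) = (\<Sum>i<m. (z i)\<^sup>2) + (\<Sum>i\<in>J. (y i)\<^sup>2)" for y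
      by (subst sum.union_disjoint) (auto simp: merge_def J J_def intro!: arg_cong2[where f="(+)"] sum.cong)
    then show "F (a - (\<Sum>i<m. (z i)\<^sup>2)) =
        (\<integral>\<^sup>+y. indicator {z. (\<Sum>i\<in>{..<m} \<union> J. (z i)\<^sup>2) \<le> a} (merge {..<m} J (z, y)) \<partial>iid_normal J)"
      unfolding F_def by (subst emeasure_Collect_eq_nn_integral)
        (auto intro!: nn_integral_cong simp: indicator_def algebra_simps)
  qed
  also have "\<dots> = (\<integral>\<^sup>+z. indicator {z. (\<Sum>i\<in>{..<m} \<union> J. (z i)\<^sup>2) \<le> a} z \<partial>iid_normal ({..<m} \<union> J))"
    unfolding iid_normal_def
    by (subst N'.product_nn_integral_fold) (auto simp: indicator_def J)
  also note J(4)
  also have "(\<integral>\<^sup>+z. indicator {z. (\<Sum>i<m + 3. (z i)\<^sup>2) \<le> a} z \<partial>iid_normal {..<m + 3}) =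
      (\<integral>\<^sup>+s. indicator {..a} s \<partial>chi_squared (m + 3))"
    by (subst nn_integral_chi_squared[where I="{..<m + 3}" and g="indicator {..a}", simplified, symmetric]) (auto intro!: nn_integral_cong simp: indicator_def)
  also have "\<dots> = emeasure (chi_squared (CARD('i) + 2)) {..a}"
    unfolding m(2) by (subst nn_integral_indicator) (simp_all add: chi_squared_def)
  finally show ?thesis .
qed

subsection \<open>The law of a multivariate normal vector\<close>

lemma Basis_vec_eq_range_axis: "(Basis :: (real^'k) set) = range (\<lambda>k. axis k 1)"
  by (auto simp: Basis_vec_def)

lemma measurable_vec_lambda [measurable]:
  "(\<lambda>z. (\<chi> k. z k) :: real^'k) \<in> borel_measurable (Pi\<^sub>M UNIV (\<lambda>_. borel))"
  by (subst borel_measurable_euclidean_space) (simp add: Basis_vec_eq_range_axis inner_axis)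

lemma measurable_vec_nth [measurable]: "(\<lambda>y :: real^'k. y $ k) \<in> borel_measurable borel"
  by (intro borel_measurable_continuous_onI continuous_intros)

lemma measurable_vec_nth_PiM [measurable]:
  "(($) :: real^'k \<Rightarrow> 'k \<Rightarrow> real) \<in> borel \<rightarrow>\<^sub>M Pi\<^sub>M UNIV (\<lambda>_. lborel)"
  by (intro measurable_PiM_single') (auto simp: space_PiM)

text \<open>Lebesgue measure of a box in \<open>real^'k\<close> is a product over basis vectors, and
  these correspond one to one to the indices through \<open>axis k 1\<close>. Integrals over vectors
  can thus be exchanged with integrals over functions \<open>'k \<Rightarrow> real\<close>.\<close>

lemma distr_lborel_vec_nth:
  "distr lborel (Pi\<^sub>M UNIV (\<lambda>_. lborel)) (($) :: real^'k \<Rightarrow> 'k \<Rightarrow> real) = Pi\<^sub>M UNIV (\<lambda>_. lborel)"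
proof -
  interpret L: product_sigma_finite "\<lambda>_ :: 'k. lborel :: real measure" ..
  have inj: "inj (\<lambda>k :: 'k. axis k (1 :: real))"
    by (auto intro!: injI simp: axis_eq_axis)
  show ?thesis
  proof (rule L.PiM_eqI)
    fix A :: "'k \<Rightarrow> real set" assume A: "\<And>k. k \<in> UNIV \<Longrightarrow> A k \<in> sets lborel"
    \<comment> \<open>\<open>ix\<close> sends a basis vector back to its index, as the product rule
      for \<open>lborel\<close> runs over \<open>Basis\<close>.\<close>
    define ix where "ix = inv (\<lambda>k :: 'k. axis k (1 :: real))"
    have ix: "ix (axis k 1) = k" for k
      unfolding ix_def by (rule inv_f_f[OF inj])
    have [measurable]: "A k \<in> sets borel" for k
      using A by simp
    have "emeasure (distr lborel (Pi\<^sub>M UNIV (\<lambda>_. lborel)) (($) :: real^'k \<Rightarrow> 'k \<Rightarrow> real)) (Pi\<^sub>E UNIV A)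
        = emeasure lborel (($) -` (Pi\<^sub>E UNIV A) :: (real^'k) set)"
      using A by (subst emeasure_distr) (auto intro!: sets_PiM_I_finite)
    also have "\<dots> = (\<integral>\<^sup>+y. indicator (($) -` (Pi\<^sub>E UNIV A)) (y :: real^'k) \<partial>lborel)"
      using measurable_sets[OF measurable_vec_nth_PiM, of "Pi\<^sub>E UNIV A"] A
      by (subst nn_integral_indicator) (auto intro!: sets_PiM_I_finite)
    also have "\<dots> = (\<integral>\<^sup>+y. (\<Prod>b\<in>Basis. indicator (A (ix b)) ((y :: real^'k) \<bullet> b)) \<partial>lborel)"
    proof (intro nn_integral_cong)
      fix y :: "real^'k"
      have "(\<Prod>b\<in>Basis. indicator (A (ix b)) (y \<bullet> b)) = (\<Prod>k\<in>UNIV. indicator (A k) (y $ k) :: ennreal)"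
        unfolding Basis_vec_eq_range_axis by (subst prod.reindex[OF inj]) (simp add: ix inner_axis)
      moreover have "(\<Prod>k\<in>UNIV. indicator (A k) (y $ k)) = (indicator (($) -` (Pi\<^sub>E UNIV A)) y :: ennreal)"
        by (cases "\<forall>k. y $ k \<in> A k") (auto simp: indicator_def)
      ultimately show "indicator (($) -` (Pi\<^sub>E UNIV A)) y = (\<Prod>b\<in>Basis. indicator (A (ix b)) (y \<bullet> b) :: ennreal)"
        by simp
    qed
    also have "\<dots> = (\<Prod>b\<in>(Basis :: (real^'k) set). \<integral>\<^sup>+x. indicator (A (ix b)) x \<partial>lborel)"
      using nn_integral_lborel_prod[where f="\<lambda>b :: real^'k. indicator (A (ix b))"]
      by simp
    also have "\<dots> = (\<Prod>k\<in>UNIV. emeasure lborel (A k))"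
      unfolding Basis_vec_eq_range_axis by (subst prod.reindex[OF inj]) (simp add: ix)
    finally show "emeasure (distr lborel (Pi\<^sub>M UNIV (\<lambda>_. lborel)) (($) :: real^'k \<Rightarrow> 'k \<Rightarrow> real)) (Pi\<^sub>E UNIV A)
        = (\<Prod>k\<in>UNIV. emeasure lborel (A k))" .
  qed simp_all
qed

lemma nn_integral_lborel_vec:
  fixes h :: "real^'k \<Rightarrow> ennreal"
  assumes [measurable]: "h \<in> borel_measurable borel"
  shows "(\<integral>\<^sup>+y. h y \<partial>lborel) = (\<integral>\<^sup>+z. h (\<chi> k. z k) \<partial>Pi\<^sub>M UNIV (\<lambda>_. lborel))"
proof -
  have "(\<integral>\<^sup>+z. h (\<chi> k. z k) \<partial>Pi\<^sub>M UNIV (\<lambda>_. lborel)) = (\<integral>\<^sup>+y. h (\<chi> k. y $ k) \<partial>lborel)"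
    by (subst distr_lborel_vec_nth[symmetric], subst nn_integral_distr) simp_all
  then show ?thesis by simp
qed

text \<open>
  Uniqueness of Haar measure: with \<open>T\<close> in place of the identity on one side, Fubini's theorem
  and translation invariance let \<open>f\<close> and an auxiliary test function \<open>g\<close> exchange roles.
\<close>

lemma nn_integral_lborel_linear_image:
  fixes T U :: "'a::euclidean_space \<Rightarrow> 'a"
  assumes "linear T" "linear U" and inv: "\<And>y. T (U y) = y"
  obtains c where "\<And>f. f \<in> borel_measurable borel \<Longrightarrow>
    (\<integral>\<^sup>+x. f (T x) \<partial>lborel) = c * (\<integral>\<^sup>+y. f y \<partial>lborel)"
proof -
  have [measurable]: "T \<in> borel_measurable borel"
    using \<open>linear T\<close> by (intro borel_measurable_continuous_onI linear_continuous_on linear_conv_bounded_linear[THEN iffD1])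
  have shift: "(\<integral>\<^sup>+x. h (x + v) \<partial>lborel) = (\<integral>\<^sup>+x. h x \<partial>lborel)"
    if [measurable]: "h \<in> borel_measurable borel" for h :: "'a \<Rightarrow> ennreal" and v
    by (subst (2) lborel_distr_plus[of v, symmetric]) (simp add: nn_integral_distr add.commute)
  \<comment> \<open>Any test function whose integral \<open>m\<close> is neither zero nor infinite
    would do; the unit ball permits the final cancellation of \<open>m\<close>.\<close>
  define g :: "'a \<Rightarrow> ennreal" where "g = indicator (cball 0 1)"
  have [measurable]: "g \<in> borel_measurable borel"
    unfolding g_def by (intro borel_measurable_indicator) simp
  define m where "m = (\<integral>\<^sup>+y. g y \<partial>lborel)"
  have m: "m \<noteq> 0" "m \<noteq> \<top>"
  proof -
    have "m = emeasure lborel (cball (0 :: 'a) 1)"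
      by (simp add: m_def g_def)
    moreover have "emeasure lborel (cball (0 :: 'a) 1) < \<infinity>"
      by (rule emeasure_bounded_finite) simp
    moreover have "measure lborel (cball (0 :: 'a) 1) > 0"
      by (rule content_cball_pos) simp
    ultimately show "m \<noteq> 0" "m \<noteq> \<top>"
      by (auto simp: measure_def)
  qed
  \<comment> \<open>Forced by the calculation below: \<open>c * m\<close> is the integral of
    \<open>g (y - T x)\<close> over \<open>x\<close>, which does not depend on
    \<open>y\<close>.\<close>
  define c where "c = (\<integral>\<^sup>+x. g (- T x) \<partial>lborel) / m"
  have "(\<integral>\<^sup>+x. f (T x) \<partial>lborel) = c * (\<integral>\<^sup>+y. f y \<partial>lborel)"
    if [measurable]: "f \<in> borel_measurable borel" for f
  proof -
    have "(\<integral>\<^sup>+x. f (T x) \<partial>lborel) * m = (\<integral>\<^sup>+y. (\<integral>\<^sup>+x. f (T x) \<partial>lborel) * g y \<partial>lborel)"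
      unfolding m_def by (rule nn_integral_cmult[symmetric]) measurable
    also have "\<dots> = (\<integral>\<^sup>+y. (\<integral>\<^sup>+x. f (T x + y) * g y \<partial>lborel) \<partial>lborel)"
    proof (intro nn_integral_cong)
      fix y
      \<comment> \<open>Since \<open>T (U y) = y\<close>, translating \<open>x\<close> by
        \<open>U y\<close> translates \<open>T x\<close> by \<open>y\<close>.\<close>
      have "(\<integral>\<^sup>+x. f (T x) \<partial>lborel) = (\<integral>\<^sup>+x. f (T x + y) \<partial>lborel)"
        using shift[of "\<lambda>x. f (T x)" "U y"] by (simp add: linear_add[OF \<open>linear T\<close>] inv)
      then show "(\<integral>\<^sup>+x. f (T x) \<partial>lborel) * g y = (\<integral>\<^sup>+x. f (T x + y) * g y \<partial>lborel)"
        by (simp add: nn_integral_multc)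
    qed
    also have "\<dots> = (\<integral>\<^sup>+x. (\<integral>\<^sup>+y. f (T x + y) * g y \<partial>lborel) \<partial>lborel)"
      by (rule lborel_pair.Fubini') measurable
    also have "\<dots> = (\<integral>\<^sup>+x. (\<integral>\<^sup>+y. f y * g (y - T x) \<partial>lborel) \<partial>lborel)"
    proof (rule nn_integral_cong)
      fix x
      show "(\<integral>\<^sup>+y. f (T x + y) * g y \<partial>lborel) = (\<integral>\<^sup>+y. f y * g (y - T x) \<partial>lborel)"
        using shift[of "\<lambda>y. f y * g (y - T x)" "T x"] by (simp add: add.commute)
    qed
    also have "\<dots> = (\<integral>\<^sup>+y. (\<integral>\<^sup>+x. f y * g (y - T x) \<partial>lborel) \<partial>lborel)"
      by (rule lborel_pair.Fubini') measurable
    also have "\<dots> = (\<integral>\<^sup>+y. f y * (c * m) \<partial>lborel)"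
    proof (intro nn_integral_cong)
      fix y
      have "(\<integral>\<^sup>+x. g (y - T x) \<partial>lborel) = (\<integral>\<^sup>+x. g (- T x) \<partial>lborel)"
        using shift[of "\<lambda>x. g (y - T x)" "U y"] by (simp add: linear_add[OF \<open>linear T\<close>] inv)
      also have "\<dots> = c * m"
        using m by (simp add: c_def ennreal_divide_times divide_eq_1_ennreal ennreal_times_divide mult_divide_eq_ennreal)
      finally show "(\<integral>\<^sup>+x. f y * g (y - T x) \<partial>lborel) = f y * (c * m)"
        by (simp add: nn_integral_cmult)
    qed
    also have "\<dots> = c * (\<integral>\<^sup>+y. f y \<partial>lborel) * m"
      by (subst nn_integral_multc) (simp_all add: mult_ac)
    finally show ?thesis
      using m by (metis mult_divide_eq_ennreal)
  qed
  then show thesis by (rule that)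
qed

text \<open>
  The laws on both sides have densities proportional to the same function; as probability
  measures they coincide, so neither the Jacobian nor \<open>det S\<close> has to be computed.
\<close>

lemma distr_multivariate_normal:
  fixes T U :: "real^'k \<Rightarrow> real^'k"
  assumes "prob_space P" and D: "distributed P lborel D (mvn_density 0 S)"
    and "linear T" "linear U" and inv: "\<And>y. T (U y) = y"
    and quad: "\<And>z. T z \<bullet> (matrix_inv S *v T z) = z \<bullet> z"
  shows "distr P borel D = distr (iid_normal UNIV) borel (\<lambda>z. T (\<chi> k. z k))"
proof -
  interpret P: prob_space P by fact
  interpret N: prob_space "iid_normal (UNIV :: 'k set)" by (rule prob_space_iid_normal)
  have T [measurable]: "T \<in> borel_measurable borel"
    using \<open>linear T\<close> by (intro borel_measurable_continuous_onI linear_continuous_on linear_conv_bounded_linear[THEN iffD1])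
  have D' [measurable]: "D \<in> borel_measurable P"
    using distributed_measurable[OF D] by simp
  define h where "h y = ennreal (exp (- (y \<bullet> (matrix_inv S *v y)) / 2))" for y
  have [measurable]: "h \<in> borel_measurable borel"
    unfolding h_def
    by (intro measurable_compose[OF _ measurable_ennreal] borel_measurable_continuous_onI continuous_intros
        linear_continuous_on matrix_vector_mul_bounded_linear) simp
  define J where "J A = (\<integral>\<^sup>+y. h y * indicator A y \<partial>lborel)" for A
  obtain c where c: "\<And>f. f \<in> borel_measurable borel \<Longrightarrow>
      (\<integral>\<^sup>+x. f (T x) \<partial>lborel) = c * (\<integral>\<^sup>+y. f y \<partial>lborel)"
    using nn_integral_lborel_linear_image[OF \<open>linear T\<close> \<open>linear U\<close> inv] by blast
  have M [measurable]: "(\<lambda>z. T (\<chi> k. z k)) \<in> borel_measurable (iid_normal UNIV)"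
    by measurable
  have 1: "\<exists>C. \<forall>A\<in>sets borel. emeasure (distr P borel D) A = C * J A"
  proof (intro exI ballI)
    fix A :: "(real^'k) set" assume [measurable]: "A \<in> sets borel"
    let ?C = "1 / sqrt ((2 * pi) ^ CARD('k) * det S)"
    have "emeasure (distr P borel D) A = emeasure P (D -` A \<inter> space P)"
      by (simp add: emeasure_distr)
    also have "\<dots> = (\<integral>\<^sup>+y. ennreal (mvn_density 0 S y) * indicator A y \<partial>lborel)"
      by (intro distributed_emeasure[OF D]) simp
    also have "\<dots> = (\<integral>\<^sup>+y. ennreal ?C * (h y * indicator A y) \<partial>lborel)"
      by (intro nn_integral_cong)
        (simp add: mvn_density_def h_def ennreal_mult''[symmetric] mult.assoc[symmetric])
    also have "\<dots> = ennreal ?C * J A"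
      unfolding J_def by (rule nn_integral_cmult) measurable
    finally show "emeasure (distr P borel D) A = ennreal ?C * J A" .
  qed
  have 2: "\<exists>C. \<forall>A\<in>sets borel. emeasure (distr (iid_normal UNIV) borel (\<lambda>z. T (\<chi> k. z k))) A = C * J A"
  proof (intro exI ballI)
    fix A :: "(real^'k) set" assume [measurable]: "A \<in> sets borel"
    let ?C = "(1 / sqrt (2 * pi)) ^ CARD('k)"
    \<comment> \<open>By \<open>quad\<close>, the quadratic form of \<open>S\<close> pulled back
      along \<open>T\<close> is the plain sum of squares in the standard normal density.\<close>
    have hT: "h (T (\<chi> k. z k)) = ennreal (exp (- (\<Sum>i\<in>UNIV. (z i)\<^sup>2) / 2))" for z
      unfolding h_def quad by (simp add: inner_vec_def power2_eq_square)
    have "emeasure (distr (iid_normal UNIV) borel (\<lambda>z. T (\<chi> k. z k))) A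
        = (\<integral>\<^sup>+z. indicator A (T (\<chi> k. z k)) \<partial>iid_normal UNIV)"
      using nn_integral_distr[OF M, of "indicator A"] by simp
    also have "\<dots> = (\<integral>\<^sup>+z. (\<Prod>i\<in>UNIV. ennreal (std_normal_density (z i))) *
        indicator A (T (\<chi> k. z k)) \<partial>Pi\<^sub>M UNIV (\<lambda>_. lborel))"
      using M unfolding iid_normal_eq_density[OF finite]
      by (intro nn_integral_density) simp_all
    also have "\<dots> = (\<integral>\<^sup>+z. ennreal ?C * (h (T (\<chi> k. z k)) * indicator A (T (\<chi> k. z k)))
        \<partial>Pi\<^sub>M UNIV (\<lambda>_. lborel))"
      by (intro nn_integral_cong)
        (simp add: hT prod_ennreal prod_std_normal_density ennreal_mult mult.assoc)
    also have "\<dots> = (\<integral>\<^sup>+y. ennreal ?C * (h (T y) * indicator A (T y)) \<partial>lborel)"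
      by (rule nn_integral_lborel_vec[symmetric]) measurable
    also have "\<dots> = c * (\<integral>\<^sup>+y. ennreal ?C * (h y * indicator A y) \<partial>lborel)"
      by (rule c) measurable
    also have "\<dots> = c * ennreal ?C * J A"
      unfolding J_def by (subst nn_integral_cmult) (simp_all add: mult.assoc)
    finally show "emeasure (distr (iid_normal UNIV) borel (\<lambda>z. T (\<chi> k. z k))) A = c * ennreal ?C * J A" .
  qed
  obtain C1 where C1: "\<And>A. A \<in> sets borel \<Longrightarrow> emeasure (distr P borel D) A = C1 * J A"
    using 1 by blast
  obtain C2 where C2: "\<And>A. A \<in> sets borel \<Longrightarrow>
      emeasure (distr (iid_normal UNIV) borel (\<lambda>z. T (\<chi> k. z k))) A = C2 * J A"
    using 2 by blast
  \<comment> \<open>On the whole space both laws have mass one: each constant is an inverse of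
    \<open>J UNIV\<close>, hence they agree.\<close>
  have "C1 * J UNIV = 1" "C2 * J UNIV = 1"
    using prob_space.emeasure_space_1[OF P.prob_space_distr[OF D']]
      prob_space.emeasure_space_1[OF N.prob_space_distr[OF M]]
    by (simp_all add: C1[symmetric] C2[symmetric])
  then have "C1 = C2"
    by (metis mult.assoc mult.commute mult.right_neutral)
  then show ?thesis
    by (intro measure_eqI) (simp_all add: C1 C2)
qed

subsection \<open>Moments on sign-symmetric events\<close>

definition negate_coord :: "'i \<Rightarrow> ('i \<Rightarrow> real) \<Rightarrow> 'i \<Rightarrow> real" where
  "negate_coord k z = z(k := - z k)"

lemma measurable_negate_coord [measurable]:
  "negate_coord k \<in> iid_normal UNIV \<rightarrow>\<^sub>M iid_normal UNIV"
  unfolding negate_coord_def iid_normal_def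
  by (intro measurable_PiM_single') (auto simp: space_PiM)

text \<open>The standard normal density is even, and reflecting one coordinate maps boxes to boxes.
  This is the symmetry behind all vanishing moments below.\<close>

lemma distr_iid_normal_negate_coord:
  fixes k :: "'i::finite"
  shows "distr (iid_normal UNIV) (iid_normal UNIV) (negate_coord k) = iid_normal UNIV"
proof -
  interpret N: product_sigma_finite "\<lambda>_ :: 'i. std_normal"
    by (rule product_sigma_finite_std_normal)
  have sym: "emeasure std_normal (uminus -` A) = emeasure std_normal A" if [measurable]: "A \<in> sets borel" for A
  proof -
    have "emeasure std_normal (uminus -` A) =
        (\<integral>\<^sup>+x. ennreal (std_normal_density x) * indicator A (- x) \<partial>lborel)"
      unfolding std_normal_def by (subst emeasure_density) (auto simp: indicator_def vimage_def)
    also have "\<dots> = (\<integral>\<^sup>+x. ennreal (std_normal_density (- x)) * indicator A (- x) \<partial>lborel)"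
      by (simp add: std_normal_density_def)
    also have "\<dots> = (\<integral>\<^sup>+x. ennreal (std_normal_density x) * indicator A x \<partial>lborel)"
      by (subst (2) lborel_distr_uminus[symmetric], subst nn_integral_distr) simp_all
    also have "\<dots> = emeasure std_normal A"
      unfolding std_normal_def by (simp add: emeasure_density)
    finally show ?thesis .
  qed
  have "distr (iid_normal UNIV) (iid_normal UNIV) (negate_coord k) = Pi\<^sub>M UNIV (\<lambda>_. std_normal)"
  proof (rule N.PiM_eqI)
    fix A :: "'i \<Rightarrow> real set" assume A: "\<And>i. i \<in> UNIV \<Longrightarrow> A i \<in> sets std_normal"
    let ?B = "A(k := uminus -` A k)"
    have "emeasure (distr (iid_normal UNIV) (iid_normal UNIV) (negate_coord k)) (Pi\<^sub>E UNIV A)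
        = emeasure (iid_normal UNIV) (negate_coord k -` Pi\<^sub>E UNIV A \<inter> space (iid_normal UNIV))"
      using A by (intro emeasure_distr measurable_negate_coord) (auto simp: iid_normal_def intro!: sets_PiM_I_finite)
    also have "negate_coord k -` Pi\<^sub>E UNIV A \<inter> space (iid_normal UNIV) = Pi\<^sub>E UNIV ?B"
      by (auto simp: negate_coord_def space_iid_normal PiE_iff split: if_splits)
    also have "emeasure (iid_normal UNIV) (Pi\<^sub>E UNIV ?B) = (\<Prod>i\<in>UNIV. emeasure std_normal (?B i))"
      unfolding iid_normal_def using A by (intro N.emeasure_PiM) (auto simp: vimage_def)
    also have "\<dots> = (\<Prod>i\<in>UNIV. emeasure std_normal (A i))"
      using A sym by (intro prod.cong) auto
    finally show "emeasure (distr (iid_normal UNIV) (iid_normal UNIV) (negate_coord k)) (Pi\<^sub>E UNIV A)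
        = (\<Prod>i\<in>UNIV. emeasure std_normal (A i))" .
  qed (simp_all add: iid_normal_def)
  then show ?thesis by (simp add: iid_normal_def)
qed

text \<open>The reflection preserves the measure, so the integral equals its own negative.
  Measurability suffices, as negation commutes with the integral even where the latter is
  \<open>0\<close> by default.\<close>

lemma integral_iid_normal_odd:
  fixes f :: "('i::finite \<Rightarrow> real) \<Rightarrow> real"
  assumes [measurable]: "f \<in> borel_measurable (iid_normal UNIV)"
    and odd: "\<And>z. f (negate_coord k z) = - f z"
  shows "integral\<^sup>L (iid_normal UNIV) f = 0"
proof -
  have "integral\<^sup>L (iid_normal UNIV) f = (\<integral>z. f (negate_coord k z) \<partial>iid_normal UNIV)"
    by (subst distr_iid_normal_negate_coord[of k, symmetric], subst integral_distr) simp_all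
  then show ?thesis by (simp add: odd)
qed

lemma integrable_iid_normal_square:
  fixes k :: "'i::finite"
  shows "integrable (iid_normal UNIV) (\<lambda>z. (z k)\<^sup>2)"
proof -
  have "integrable std_normal (\<lambda>x. x\<^sup>2)"
    unfolding std_normal_def using integrable_std_normal_moment[of 2]
    by (subst integrable_density) simp_all
  then have "integrable (distr (iid_normal UNIV) std_normal (\<lambda>z. z k)) (\<lambda>x. x\<^sup>2)"
    unfolding iid_normal_def
    by (subst distr_PiM_component) (simp_all add: prob_space_std_normal)
  then show ?thesis
    by (subst (asm) integrable_distr_eq) (simp_all add: iid_normal_def)
qed

lemma integrable_iid_normal_mult:
  fixes i j :: "'i::finite"
  shows "integrable (iid_normal UNIV) (\<lambda>z. z i * z j)"
proof (rule Bochner_Integration.integrable_bound)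
  show "integrable (iid_normal UNIV) (\<lambda>z. (z i)\<^sup>2 + (z j)\<^sup>2)"
    by (intro Bochner_Integration.integrable_add integrable_iid_normal_square)
  have "\<bar>x * y\<bar> \<le> x\<^sup>2 + y\<^sup>2" for x y :: real
    using sum_squares_bound[of x y] sum_squares_bound[of "-x" y] by (auto simp: abs_if)
  then show "AE z in iid_normal UNIV. norm (z i * z j) \<le> norm ((z i)\<^sup>2 + (z j)\<^sup>2)"
    by simp
qed measurable

lemma integrable_iid_normal_component:
  fixes i :: "'i::finite"
  shows "integrable (iid_normal UNIV) (\<lambda>z. z i)"
proof (rule Bochner_Integration.integrable_bound)
  interpret N: prob_space "iid_normal (UNIV :: 'i set)" by (rule prob_space_iid_normal)
  show "integrable (iid_normal UNIV) (\<lambda>z. (z i)\<^sup>2 + 1)"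
    by (intro Bochner_Integration.integrable_add integrable_iid_normal_square) simp
  have "\<bar>x\<bar> \<le> x\<^sup>2 + 1" for x :: real
    using sum_squares_bound[of x 1] sum_squares_bound[of "-x" 1] by (auto simp: abs_if)
  then show "AE z in iid_normal UNIV. norm (z i) \<le> norm ((z i)\<^sup>2 + 1)"
    by simp
qed measurable

text \<open>Reflecting coordinate \<open>k\<close> keeps \<open>B\<close>, which involves squares
  only, and flips the sign of the summand \<open>w k * z k\<close>.\<close>

lemma truncated_first_moment_linear_form:
  fixes w c :: "'i::finite \<Rightarrow> real" and t :: real
  defines "B \<equiv> {z. (\<Sum>j\<in>UNIV. c j * (z j)\<^sup>2) \<le> t}"
  shows "(\<integral>z. indicator B z * (\<Sum>k\<in>UNIV. w k * z k) \<partial>iid_normal UNIV) = 0"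
proof -
  have invariant: "indicator B (negate_coord i z) = (indicator B z :: real)" for i z
  proof -
    have "(negate_coord i z j)\<^sup>2 = (z j)\<^sup>2" for j
      by (simp add: negate_coord_def)
    then show ?thesis by (simp add: indicator_def B_def)
  qed
  have [measurable]: "(indicator B :: _ \<Rightarrow> real) \<in> borel_measurable (iid_normal UNIV)"
    unfolding indicator_def B_def by measurable
  have "integrable (iid_normal UNIV) (\<lambda>z. indicator B z * (w k * z k))" for k
    by (rule Bochner_Integration.integrable_bound[OF integrable_mult_right[OF integrable_iid_normal_component, of "w k" k]])
      (auto simp: indicator_def B_def)
  moreover have "(\<integral>z. indicator B z * (w k * z k) \<partial>iid_normal UNIV) = 0" for k
    by (rule integral_iid_normal_odd[of _ k]) (simp_all add: invariant, simp add: negate_coord_def)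
  ultimately show ?thesis
    unfolding sum_distrib_left by (subst Bochner_Integration.integral_sum) simp_all
qed

text \<open>In the expanded square, reflecting coordinate \<open>i\<close> flips the mixed products
  \<open>z i * z j\<close> with \<open>i \<noteq> j\<close> while preserving \<open>B\<close>; only
  the diagonal survives, whatever the weights \<open>c\<close>.\<close>

lemma truncated_second_moment_linear_form:
  fixes w c :: "'i::finite \<Rightarrow> real" and t :: real
  defines "B \<equiv> {z. (\<Sum>j\<in>UNIV. c j * (z j)\<^sup>2) \<le> t}"
  shows "(\<integral>z. indicator B z * (\<Sum>k\<in>UNIV. w k * z k)\<^sup>2 \<partial>iid_normal UNIV) =
    (\<Sum>k\<in>UNIV. (w k)\<^sup>2 * (\<integral>z. indicator B z * (z k)\<^sup>2 \<partial>iid_normal UNIV))"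
proof -
  have invariant: "indicator B (negate_coord i z) = (indicator B z :: real)" for i z
  proof -
    have "(negate_coord i z j)\<^sup>2 = (z j)\<^sup>2" for j
      by (simp add: negate_coord_def)
    then show ?thesis by (simp add: indicator_def B_def)
  qed
  have [measurable]: "(indicator B :: _ \<Rightarrow> real) \<in> borel_measurable (iid_normal UNIV)"
    unfolding indicator_def B_def by measurable
  have int: "integrable (iid_normal UNIV) (\<lambda>z. indicator B z * (z i * z j))" for i j
    by (rule Bochner_Integration.integrable_bound[OF integrable_iid_normal_mult[of i j]])
      (auto simp: indicator_def B_def)
  have cross: "(\<integral>z. indicator B z * (z i * z j) \<partial>iid_normal UNIV) = 0" if "i \<noteq> j" for i j
    using that by (intro integral_iid_normal_odd[of _ i]) (simp_all add: invariant, simp add: negate_coord_def)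
  have "indicator B z * (\<Sum>k\<in>UNIV. w k * z k)\<^sup>2 =
      (\<Sum>i\<in>UNIV. \<Sum>j\<in>UNIV. (w i * w j) * (indicator B z * (z i * z j)))" for z :: "'i \<Rightarrow> real"
    by (simp add: power2_eq_square sum_product sum_distrib_left mult_ac)
  then have "(\<integral>z. indicator B z * (\<Sum>k\<in>UNIV. w k * z k)\<^sup>2 \<partial>iid_normal UNIV) =
      (\<Sum>i\<in>UNIV. \<Sum>j\<in>UNIV. (w i * w j) * (\<integral>z. indicator B z * (z i * z j) \<partial>iid_normal UNIV))"
    using int by simp
  also have "\<dots> = (\<Sum>i\<in>UNIV. \<Sum>j\<in>UNIV. if j = i then (w i)\<^sup>2 * (\<integral>z. indicator B z * (z i)\<^sup>2 \<partial>iid_normal UNIV) else 0)"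
    using cross by (intro sum.cong refl) (auto simp: power2_eq_square)
  finally show ?thesis by simp
qed

section \<open>Conditional expectation as a quotient\<close>

lemma event_expectation_eq:
  assumes "prob_space P" and [measurable]: "A \<in> sets P" "X \<in> borel_measurable P"
  shows "event_expectation P A X = (\<integral>\<omega>. indicator A \<omega> * X \<omega> \<partial>P) / measure P A"
proof -
  interpret prob_space P by fact
  show ?thesis
  proof (cases "measure P A = 0")
    \<comment> \<open>For a null event the conditional measure is zero, so the integral is
      \<open>0\<close>, which agrees with division by \<open>0\<close> on the right.\<close>
    case True
    then have "A \<in> null_sets P"
      by (simp add: null_sets_def emeasure_eq_measure)
    then have "AE \<omega> in uniform_measure P A. X \<omega> = 0"
      by (intro AE_uniform_measureI) (auto dest: AE_not_in)
    then have "integral\<^sup>L (uniform_measure P A) X = integral\<^sup>L (uniform_measure P A) (\<lambda>_. 0)"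
      by (intro integral_cong_AE) simp_all
    then show ?thesis using True by (simp add: event_expectation_def)
  next
    case False
    have "(\<lambda>\<omega>. indicator A \<omega> / emeasure P A) = (\<lambda>\<omega>. ennreal (indicator A \<omega> / measure P A))"
      using False by (auto simp: emeasure_eq_measure indicator_def divide_ennreal[symmetric] zero_less_measure_iff
        ennreal_1[symmetric] simp del: ennreal_1)
    then have "integral\<^sup>L (uniform_measure P A) X = (\<integral>\<omega>. (indicator A \<omega> / measure P A) *\<^sub>R X \<omega> \<partial>P)"
      unfolding uniform_measure_def by (simp only:) (intro integral_density, auto)
    then show ?thesis by (simp add: event_expectation_def)
  qed
qed

text \<open>Numerator and denominator are the truncated second moment and the law of the sum of
  squares. The value is the same for every \<open>k\<close>, and for positive \<open>lam\<close> it
  is the instance of \<open>ridge_d\<close> with ridge parameter \<open>0\<close>.\<close>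

lemma maha_v_eq_truncated_moment:
  fixes k :: "'i::finite"
  shows "maha_v CARD('i) a = event_expectation (iid_normal UNIV)
    {z \<in> space (iid_normal UNIV). (\<Sum>j\<in>UNIV. (z j)\<^sup>2) \<le> a} (\<lambda>z. (z k)\<^sup>2)"
proof -
  let ?A = "{z \<in> space (iid_normal (UNIV :: 'i set)). (\<Sum>j\<in>UNIV. (z j)\<^sup>2) \<le> a}"
  have "(\<integral>z. indicator ?A z * (z k)\<^sup>2 \<partial>iid_normal UNIV) =
      enn2real (\<integral>\<^sup>+z. ennreal (indicator ?A z * (z k)\<^sup>2) \<partial>iid_normal UNIV)"
    by (intro integral_eq_nn_integral) simp_all
  also have "(\<integral>\<^sup>+z. ennreal (indicator ?A z * (z k)\<^sup>2) \<partial>iid_normal UNIV) = 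
      (\<integral>\<^sup>+z. ennreal ((z k)\<^sup>2) * indicator {z. (\<Sum>i\<in>UNIV. (z i)\<^sup>2) \<le> a} z \<partial>iid_normal UNIV)"
    by (intro nn_integral_cong) (simp add: indicator_def)
  finally have num: "(\<integral>z. indicator ?A z * (z k)\<^sup>2 \<partial>iid_normal UNIV) = measure (chi_squared (CARD('i) + 2)) {..a}"
    by (simp add: truncated_second_moment_iid_normal measure_def)
  have "measure (chi_squared CARD('i)) {..a} = measure (iid_normal UNIV) ?A"
    unfolding distr_iid_normal_eq_chi_squared[OF finite, symmetric]
    by (subst measure_distr) (auto intro!: arg_cong[where f="measure _"])
  then show ?thesis
    by (subst event_expectation_eq) (simp_all add: prob_space_iid_normal num maha_v_def)
qed

subsection \<open>Conditional variance\<close>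

text \<open>Composing with \<open>u\<close> and \<open>v\<close> makes both variables real valued
  and only shrinks the generated sigma-algebras, so independence survives and the product rule for
  real variables applies.\<close>

lemma indep_borel_integral_mult:
  fixes X :: "'a \<Rightarrow> 'b::topological_space" and Y :: "'a \<Rightarrow> 'c::topological_space"
    and u :: "'b \<Rightarrow> real" and v :: "'c \<Rightarrow> real"
  assumes "prob_space P" and indep: "indep_borel P X Y"
    and u: "u \<in> borel_measurable borel" and v: "v \<in> borel_measurable borel"
    and int: "integrable P (\<lambda>\<omega>. u (X \<omega>))" "integrable P (\<lambda>\<omega>. v (Y \<omega>))"
  shows "(\<integral>\<omega>. u (X \<omega>) * v (Y \<omega>) \<partial>P) = (\<integral>\<omega>. u (X \<omega>) \<partial>P) * (\<integral>\<omega>. v (Y \<omega>) \<partial>P)" (is ?eq)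
    and "integrable P (\<lambda>\<omega>. u (X \<omega>) * v (Y \<omega>))" (is ?int)
proof -
  interpret prob_space P by fact
  have [measurable]: "X \<in> borel_measurable P" "Y \<in> borel_measurable P"
    using indep by (simp_all add: indep_borel_def)
  have sub: "sigma_sets (space P) {(\<lambda>\<omega>. f (Z \<omega>)) -` A \<inter> space P | A. A \<in> sets borel}
      \<subseteq> sigma_sets (space P) {Z -` A \<inter> space P | A. A \<in> sets borel}"
    if "f \<in> borel_measurable borel" for f :: "'d::topological_space \<Rightarrow> real" and Z
  proof (rule sigma_sets_mono', safe)
    fix A :: "real set" assume "A \<in> sets borel"
    then have "f -` A \<in> sets borel"
      using measurable_sets[OF that, of A] by simp
    then show "\<exists>B. (\<lambda>\<omega>. f (Z \<omega>)) -` A \<inter> space P = Z -` B \<inter> space P \<and> B \<in> sets borel"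
      by (intro exI[of _ "f -` A"]) auto
  qed
  have "indep_var borel (\<lambda>\<omega>. u (X \<omega>)) borel (\<lambda>\<omega>. v (Y \<omega>))"
    unfolding indep_var_eq
  proof (intro conjI)
    show "indep_set
        (sigma_sets (space P) {(\<lambda>\<omega>. u (X \<omega>)) -` A \<inter> space P | A. A \<in> sets borel})
        (sigma_sets (space P) {(\<lambda>\<omega>. v (Y \<omega>)) -` A \<inter> space P | A. A \<in> sets borel})"
      using indep sub[OF u, of X] sub[OF v, of Y]
      unfolding indep_borel_def indep_sets2_eq by (meson subset_eq)
  qed (use u v in measurable)
  then show ?eq ?int
    using int by (rule indep_var_lebesgue_integral, rule indep_var_integrable)
qed

text \<open>
  When the conditioning event is null, \<open>event_variance\<close> and the quotient are both \<open>0\<close>, hence the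
  factor \<open>of_bool\<close>.
\<close>

lemma event_variance_add_indep:
  fixes X :: "'a \<Rightarrow> 'b::topological_space" and L :: "'b \<Rightarrow> real"
  assumes P: "prob_space P" and indep: "indep_borel P X E" and E2: "integrable P (\<lambda>\<omega>. (E \<omega>)\<^sup>2)"
    and B [measurable]: "B \<in> sets borel" and L [measurable]: "L \<in> borel_measurable borel"
    and L2: "integrable P (\<lambda>\<omega>. (L (X \<omega>))\<^sup>2)"
    and centred: "(\<integral>\<omega>. indicator B (X \<omega>) * L (X \<omega>) \<partial>P) = 0"
    and Y: "\<And>\<omega>. \<omega> \<in> space P \<Longrightarrow> Y \<omega> = \<tau> + L (X \<omega>) + E \<omega>"
  shows "event_variance P {\<omega> \<in> space P. X \<omega> \<in> B} Y =
    (\<integral>\<omega>. indicator B (X \<omega>) * (L (X \<omega>))\<^sup>2 \<partial>P) / measure P {\<omega> \<in> space P. X \<omega> \<in> B}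
    + of_bool (measure P {\<omega> \<in> space P. X \<omega> \<in> B} \<noteq> 0) * prob_space.variance P E"
proof -
  interpret prob_space P by fact
  have [measurable]: "X \<in> borel_measurable P" "E \<in> borel_measurable P"
    using indep by (simp_all add: indep_borel_def)
  have Y_meas [measurable]: "Y \<in> borel_measurable P"
    by (subst measurable_cong[OF Y]) measurable
  let ?A = "{\<omega> \<in> space P. X \<omega> \<in> B}"
  let ?m = "expectation E"
  have [measurable]: "?A \<in> sets P"
    by measurable
  have Eint: "integrable P E"
    using square_integrable_imp_integrable[OF _ E2] by simp
  have Lint: "integrable P (\<lambda>\<omega>. L (X \<omega>))"
    using square_integrable_imp_integrable[OF _ L2] by simp
  have Bint: "integrable P (\<lambda>\<omega>. indicator B (X \<omega>) :: real)"
    by (intro integrable_const_bound[of _ 1]) (auto simp: indicator_def)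
  have BLint: "integrable P (\<lambda>\<omega>. indicator B (X \<omega>) * L (X \<omega>))"
    by (rule Bochner_Integration.integrable_bound[OF Lint]) (auto simp: indicator_def)
  have BL2int: "integrable P (\<lambda>\<omega>. indicator B (X \<omega>) * (L (X \<omega>))\<^sup>2)"
    by (rule Bochner_Integration.integrable_bound[OF L2]) (auto simp: indicator_def)
  have B_eq: "expectation (\<lambda>\<omega>. indicator B (X \<omega>)) = prob ?A"
  proof -
    have "expectation (\<lambda>\<omega>. indicator B (X \<omega>)) = expectation (indicator ?A :: 'a \<Rightarrow> real)"
      by (intro Bochner_Integration.integral_cong) (auto simp: indicator_def)
    then show ?thesis by simp
  qed
  have cond: "event_expectation P ?A Z = expectation (\<lambda>\<omega>. indicator B (X \<omega>) * W \<omega>) / prob ?A"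
    if "Z \<in> borel_measurable P" "\<And>\<omega>. \<omega> \<in> space P \<Longrightarrow> Z \<omega> = W \<omega>" for Z W
    using that by (subst event_expectation_eq[OF P])
      (auto intro!: arg_cong2[where f="(/)"] Bochner_Integration.integral_cong simp: indicator_def)
  have E_int: "integrable P (\<lambda>\<omega>. E \<omega> - ?m)" "integrable P (\<lambda>\<omega>. (E \<omega> - ?m)\<^sup>2)"
    using Eint E2 by (auto simp: power2_diff)
  \<comment> \<open>Centring \<open>E\<close> at \<open>?m\<close> makes every term linear in
    \<open>E \<omega> - ?m\<close> integrate to zero; the squared term factors into
    \<open>prob ?A\<close> times the variance of \<open>E\<close>.\<close>
  note prod1 = indep_borel_integral_mult[OF P indep, of "indicator B" "\<lambda>e. e - ?m"]
  note prod2 = indep_borel_integral_mult[OF P indep, of "indicator B" "\<lambda>e. (e - ?m)\<^sup>2"]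
  note prod3 = indep_borel_integral_mult[OF P indep, of "\<lambda>x. indicator B x * L x" "\<lambda>e. e - ?m"]
  show ?thesis
  proof (cases "prob ?A = 0")
    case True
    then show ?thesis
      by (simp add: event_variance_def event_expectation_eq[OF P])
  next
    case pos: False
    \<comment> \<open>The conditional mean: by \<open>centred\<close> the part from \<open>L\<close>
      drops out, and \<open>E\<close> contributes its unconditional mean, as \<open>B\<close>
      concerns \<open>X\<close> alone.\<close>
    have "event_expectation P ?A Y = expectation (\<lambda>\<omega>. indicator B (X \<omega>) * ((\<tau> + ?m) + L (X \<omega>) + (E \<omega> - ?m))) / prob ?A"
      by (rule cond) (simp_all add: Y)
    also have "expectation (\<lambda>\<omega>. indicator B (X \<omega>) * ((\<tau> + ?m) + L (X \<omega>) + (E \<omega> - ?m))) =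
        expectation (\<lambda>\<omega>. (\<tau> + ?m) * indicator B (X \<omega>) + indicator B (X \<omega>) * L (X \<omega>) +
          indicator B (X \<omega>) * (E \<omega> - ?m))"
      by (simp add: algebra_simps)
    also have "\<dots> = (\<tau> + ?m) * prob ?A"
      using prod1 Bint BLint E_int Eint by (simp add: centred B_eq prob_space)
    finally have mean: "event_expectation P ?A Y = \<tau> + ?m"
      using pos by simp
    have expand: "i * (x + e)\<^sup>2 = i * x\<^sup>2 + 2 * (i * x * e) + i * e\<^sup>2" for i x e :: real
      by (simp add: power2_sum algebra_simps)
    have "event_variance P ?A Y =
        expectation (\<lambda>\<omega>. indicator B (X \<omega>) * (L (X \<omega>) + (E \<omega> - ?m))\<^sup>2) / prob ?A"
      unfolding event_variance_def mean by (rule cond) (simp_all add: Y algebra_simps)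
    also have "expectation (\<lambda>\<omega>. indicator B (X \<omega>) * (L (X \<omega>) + (E \<omega> - ?m))\<^sup>2) =
        expectation (\<lambda>\<omega>. indicator B (X \<omega>) * (L (X \<omega>))\<^sup>2 + 2 * (indicator B (X \<omega>) * L (X \<omega>) * (E \<omega> - ?m))
          + indicator B (X \<omega>) * (E \<omega> - ?m)\<^sup>2)"
      by (intro Bochner_Integration.integral_cong refl expand)
    also have "\<dots> = expectation (\<lambda>\<omega>. indicator B (X \<omega>) * (L (X \<omega>))\<^sup>2) + prob ?A * variance E"
      using prod2 prod3 Bint BLint BL2int E_int Eint by (simp add: centred B_eq)
    finally show ?thesis
      using pos by (simp add: add_divide_distrib)
  qed
qed

section \<open>Orthogonally diagonalised quadratic forms\<close>

lemma diag_mat_vector_mult: "diag_mat f *v y = (\<chi> k. f k * y $ k)"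
  by (simp add: diag_mat_def matrix_vector_mult_def vec_eq_iff if_distrib[of "\<lambda>a. a * _"] cong: if_cong)

lemma diag_mat_mult: "diag_mat f ** diag_mat g = diag_mat (\<lambda>k. f k * g k)"
  by (simp add: diag_mat_def matrix_matrix_mult_def vec_eq_iff if_distrib[of "\<lambda>a. a * _"]
      if_distrib[of "\<lambda>a. _ * a"] cong: if_cong)

text \<open>\<open>G\<close> moves across the inner product as its transpose, so the form is
  diagonal in the coordinates \<open>transpose G *v y\<close>. It evaluates both the distances and
  the right-hand side of the theorem.\<close>

lemma inner_conjugated_diag_mat:
  fixes G :: "real^'k^'k"
  shows "y \<bullet> ((G ** diag_mat f ** transpose G) *v y) = (\<Sum>k\<in>UNIV. f k * ((transpose G *v y) $ k)\<^sup>2)"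
proof -
  have "y \<bullet> ((G ** diag_mat f ** transpose G) *v y)
      = (transpose G *v y) \<bullet> (diag_mat f *v (transpose G *v y))"
    by (simp add: matrix_vector_mul_assoc[symmetric] dot_lmul_matrix[symmetric] del: matrix_vector_mul_assoc)
  then show ?thesis
    by (simp add: diag_mat_vector_mult inner_vec_def power2_eq_square mult_ac)
qed

lemma matrix_inv_eqI:
  fixes A B :: "real^'k^'k"
  assumes "A ** B = mat 1" "B ** A = mat 1"
  shows "matrix_inv A = B"
  unfolding matrix_inv_def
proof (rule some_equality)
  fix C assume "A ** C = mat 1 \<and> C ** A = mat 1"
  then show "C = B"
    by (metis assms(1) matrix_mul_assoc matrix_mul_lid matrix_mul_rid)
qed (use assms in simp)

lemma matrix_inv_conjugated_diag_mat:
  fixes G :: "real^'k^'k"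
  assumes G: "orthogonal_matrix G" and f: "\<And>k. f k \<noteq> 0"
  shows "matrix_inv (G ** diag_mat f ** transpose G) = G ** diag_mat (\<lambda>k. inverse (f k)) ** transpose G"
proof -
  have GG: "transpose G ** G = mat 1" "G ** transpose G = mat 1"
    using G by (auto simp: orthogonal_matrix_def)
  have one: "diag_mat (\<lambda>_. 1) = (mat 1 :: real^'k^'k)"
    by (simp add: diag_mat_def mat_def)
  \<comment> \<open>Stated for arbitrary reciprocal \<open>g\<close> and \<open>h\<close>, so that
    it supplies both the left and the right inverse law.\<close>
  have conj: "(G ** diag_mat g ** transpose G) ** (G ** diag_mat h ** transpose G) = mat 1"
    if "\<And>k. g k * h k = 1" for g h :: "'k \<Rightarrow> real"
  proof -
    have "(G ** diag_mat g ** transpose G) ** (G ** diag_mat h ** transpose G) =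
        G ** diag_mat g ** (transpose G ** G) ** diag_mat h ** transpose G"
      by (simp add: matrix_mul_assoc)
    also have "\<dots> = G ** (diag_mat g ** diag_mat h) ** transpose G"
      by (simp add: GG matrix_mul_assoc)
    also have "\<dots> = mat 1"
      by (simp add: diag_mat_mult that one GG)
    finally show ?thesis .
  qed
  show ?thesis
    using f by (intro matrix_inv_eqI conj) simp_all
qed

text \<open>As \<open>G ** transpose G = mat 1\<close>, the ridge term
  \<open>l *\<^sub>R mat 1\<close> is itself conjugated by \<open>G\<close>: it keeps the
  eigenvectors and shifts each eigenvalue by \<open>l\<close>.\<close>

lemma ridge_mahalanobis_conjugated_diag_mat:
  fixes G :: "real^'k^'k"
  assumes G: "orthogonal_matrix G" and S: "S = G ** diag_mat lam ** transpose G"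
    and lam: "\<And>k. lam k + l \<noteq> 0"
  shows "ridge_mahalanobis l S y = (\<Sum>k\<in>UNIV. ((transpose G *v y) $ k)\<^sup>2 / (lam k + l))"
proof -
  have "S + l *\<^sub>R mat 1 = G ** diag_mat (\<lambda>k. lam k + l) ** transpose G"
  proof -
    have "diag_mat (\<lambda>k. lam k + l) = diag_mat lam + l *\<^sub>R mat 1"
      by (simp add: diag_mat_def mat_def vec_eq_iff)
    moreover have "G ** transpose G = mat 1"
      using G by (simp add: orthogonal_matrix_def)
    moreover have rdistrib: "(A + B) ** C = A ** C + B ** C" for A B C :: "real^'k^'k"
      by (simp add: matrix_matrix_mult_def vec_eq_iff sum.distrib distrib_right)
    ultimately show ?thesis
      by (simp add: S matrix_add_ldistrib rdistrib matrix_scalar_ac scalar_matrix_assoc[symmetric])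
  qed
  then show ?thesis
    by (simp add: ridge_mahalanobis_def matrix_inv_conjugated_diag_mat[OF G lam]
        inner_conjugated_diag_mat divide_inverse mult.commute)
qed

section \<open>Variance of the estimator under either criterion\<close>

lemma mahalanobis_eq_ridge: "mahalanobis S = ridge_mahalanobis 0 S"
  by (simp add: fun_eq_iff mahalanobis_def ridge_mahalanobis_def)

text \<open>Covers both designs, the plain one with \<open>l = 0\<close>. The contribution of
  \<open>E\<close> depends on the event only through its being null or not, so it cancels between
  events of equal probability.\<close>

lemma event_variance_ridge:
  fixes S \<Gamma> :: "real^'k^'k" and P :: "'a measure" and D :: "'a \<Rightarrow> real^'k"
  assumes P: "prob_space P" and D: "distributed P lborel D (mvn_density 0 S)"
    and \<Gamma>: "orthogonal_matrix \<Gamma>" and S: "S = \<Gamma> ** diag_mat lam ** transpose \<Gamma>"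
    and lam: "\<And>k. lam k > 0" and l: "l \<ge> 0"
    and indep: "indep_borel P D E" and E2: "integrable P (\<lambda>\<omega>. (E \<omega>)\<^sup>2)"
    and Y: "\<And>\<omega>. \<omega> \<in> space P \<Longrightarrow> Y \<omega> = \<tau> + \<beta> \<bullet> D \<omega> + E \<omega>"
  shows "event_variance P {\<omega> \<in> space P. ridge_mahalanobis l S (D \<omega>) \<le> t} Y =
    (\<Sum>k\<in>UNIV. lam k * ridge_d lam l t k * ((transpose \<Gamma> *v \<beta>) $ k)\<^sup>2) +
    of_bool (measure P {\<omega> \<in> space P. ridge_mahalanobis l S (D \<omega>) \<le> t} \<noteq> 0) * prob_space.variance P E"
proof -
  interpret P: prob_space P by fact
  let ?N = "iid_normal (UNIV :: 'k set)"
  \<comment> \<open>\<open>T\<close> is \<open>\<Gamma>\<close> times the square root of the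
    eigenvalue matrix and takes a vector of independent standard normals to the law of
    \<open>D\<close>; \<open>U\<close> is its inverse.\<close>
  define T where "T z = (\<Gamma> ** diag_mat (\<lambda>k. sqrt (lam k))) *v z" for z :: "real^'k"
  define U where "U y = (diag_mat (\<lambda>k. inverse (sqrt (lam k))) ** transpose \<Gamma>) *v y" for y :: "real^'k"
  have GG: "transpose \<Gamma> ** \<Gamma> = mat 1" "\<Gamma> ** transpose \<Gamma> = mat 1"
    using \<Gamma> by (auto simp: orthogonal_matrix_def)
  have lam': "lam k \<noteq> 0" "lam k + l \<noteq> 0" "sqrt (lam k) \<noteq> 0" "lam k + 0 \<noteq> 0" for k
    using lam[of k] l by auto
  have GT: "(transpose \<Gamma> *v T z) $ k = sqrt (lam k) * z $ k" for z k
    by (simp add: T_def matrix_vector_mul_assoc matrix_mul_assoc GG) (simp add: diag_mat_vector_mult)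
  have linT: "linear T" and linU: "linear U"
    unfolding T_def U_def by (rule matrix_vector_mul_linear)+
  have inv: "T (U y) = y" for y
  proof -
    have "T (U y) = (\<Gamma> ** (diag_mat (\<lambda>k. sqrt (lam k)) ** diag_mat (\<lambda>k. inverse (sqrt (lam k)))) ** transpose \<Gamma>) *v y"
      by (simp add: T_def U_def matrix_vector_mul_assoc matrix_mul_assoc)
    also have "diag_mat (\<lambda>k. sqrt (lam k)) ** diag_mat (\<lambda>k. inverse (sqrt (lam k))) = (mat 1 :: real^'k^'k)"
      using lam' by (simp add: diag_mat_mult) (simp add: diag_mat_def mat_def)
    finally show ?thesis by (simp add: GG)
  qed
  \<comment> \<open>General in \<open>r\<close>: the case \<open>r = 0\<close> yields
    \<open>quad\<close>, hence the law of \<open>D\<close>, and \<open>r = l\<close> describes the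
    conditioning event.\<close>
  have ridgeT: "ridge_mahalanobis r S (T z) = (\<Sum>k\<in>UNIV. lam k / (lam k + r) * (z $ k)\<^sup>2)"
    if "\<And>k. lam k + r \<noteq> 0" for r z
    using lam[THEN less_imp_le]
    by (simp add: ridge_mahalanobis_conjugated_diag_mat[OF \<Gamma> S that] GT power_mult_distrib
        del: transpose_matrix_vector)
  have quad: "T z \<bullet> (matrix_inv S *v T z) = z \<bullet> z" for z
  proof -
    have "T z \<bullet> (matrix_inv S *v T z) = ridge_mahalanobis 0 S (T z)"
      by (simp add: ridge_mahalanobis_def)
    also have "\<dots> = z \<bullet> z"
      using ridgeT[OF lam'(4), of z] lam'(1) by (simp add: inner_vec_def power2_eq_square)
    finally show ?thesis .
  qed
  have law: "distr P borel D = distr ?N borel (\<lambda>z. T (\<chi> k. z k))"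
    by (rule distr_multivariate_normal[OF P D linT linU inv quad])
  have [measurable]: "D \<in> borel_measurable P"
    using distributed_measurable[OF D] by simp
  have [measurable]: "T \<in> borel_measurable borel"
    using linT by (intro borel_measurable_continuous_onI linear_continuous_on linear_conv_bounded_linear[THEN iffD1])
  have TM [measurable]: "(\<lambda>z. T (\<chi> k. z k)) \<in> borel_measurable ?N"
    by measurable
  let ?w = "\<lambda>k. sqrt (lam k) * (transpose \<Gamma> *v \<beta>) $ k"
  \<comment> \<open>The same event on two sides: \<open>B\<close> for values of \<open>D\<close>,
    \<open>B'\<close> for standard normal coordinates, with the weights of
    \<open>ridge_d\<close>.\<close>
  define B where "B = {y. ridge_mahalanobis l S y \<le> t}"
  define B' where "B' = {z :: 'k \<Rightarrow> real. (\<Sum>k\<in>UNIV. lam k / (lam k + l) * (z k)\<^sup>2) \<le> t}"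
  have B_meas [measurable]: "B \<in> sets borel"
  proof -
    have "ridge_mahalanobis l S \<in> borel_measurable borel"
      unfolding ridge_mahalanobis_def[abs_def]
      by (intro borel_measurable_continuous_onI continuous_intros
          linear_continuous_on matrix_vector_mul_bounded_linear)
    then show ?thesis by (simp add: B_def)
  qed
  have T_mem: "T (\<chi> k. z k) \<in> B \<longleftrightarrow> z \<in> B'" for z
    by (simp add: B_def B'_def ridgeT[OF lam'(2)])
  then have BT: "indicator B (T (\<chi> k. z k)) = (indicator B' z :: real)" for z
    by (simp add: indicator_def)
  have \<beta>T: "\<beta> \<bullet> T (\<chi> k. z k) = (\<Sum>k\<in>UNIV. ?w k * z k)" for z
  proof -
    have "\<beta> \<bullet> T (\<chi> k. z k) = (transpose \<Gamma> *v \<beta>) \<bullet> (diag_mat (\<lambda>k. sqrt (lam k)) *v (\<chi> k. z k))"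
      by (simp add: T_def dot_lmul_matrix[symmetric] matrix_vector_mul_assoc[symmetric])
    then show ?thesis by (simp add: diag_mat_vector_mult inner_vec_def mult_ac)
  qed
  have transfer: "(\<integral>\<omega>. f (D \<omega>) \<partial>P) = (\<integral>z. f (T (\<chi> k. z k)) \<partial>?N)"
    if "f \<in> borel_measurable borel" for f :: "real^'k \<Rightarrow> real"
    using that integral_distr[of D P borel f] integral_distr[OF TM, of f] by (simp add: law)
  have L2: "integrable P (\<lambda>\<omega>. (\<beta> \<bullet> D \<omega>)\<^sup>2)"
  proof -
    have "integrable ?N (\<lambda>z. \<Sum>i\<in>UNIV. \<Sum>j\<in>UNIV. (?w i * ?w j) * (z i * z j))"
      by (intro Bochner_Integration.integrable_sum integrable_mult_right integrable_iid_normal_mult)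
    then have "integrable ?N (\<lambda>z. (\<beta> \<bullet> T (\<chi> k. z k))\<^sup>2)"
      unfolding \<beta>T by (simp add: power2_eq_square sum_product mult_ac)
    then have "integrable (distr P borel D) (\<lambda>y. (\<beta> \<bullet> y)\<^sup>2)"
      unfolding law by (subst integrable_distr_eq) simp_all
    then show ?thesis by (subst (asm) integrable_distr_eq) simp_all
  qed
  have "(\<integral>\<omega>. indicator B (D \<omega>) * (\<beta> \<bullet> D \<omega>) \<partial>P) = (\<integral>z. indicator B' z * (\<Sum>k\<in>UNIV. ?w k * z k) \<partial>?N)"
    by (subst transfer) (simp_all only: BT \<beta>T, measurable)
  also have "\<dots> = 0"
    unfolding B'_def by (rule truncated_first_moment_linear_form)
  finally have centred: "(\<integral>\<omega>. indicator B (D \<omega>) * (\<beta> \<bullet> D \<omega>) \<partial>P) = 0" .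
  have A: "{\<omega> \<in> space P. ridge_mahalanobis l S (D \<omega>) \<le> t} = {\<omega> \<in> space P. D \<omega> \<in> B}"
    by (simp add: B_def)
  have B'_meas [measurable]: "{z \<in> space ?N. z \<in> B'} \<in> sets ?N"
    unfolding B'_def by simp
  have prob: "measure P {\<omega> \<in> space P. D \<omega> \<in> B} = measure ?N {z \<in> space ?N. z \<in> B'}"
  proof -
    have "measure P {\<omega> \<in> space P. D \<omega> \<in> B} = measure (distr P borel D) B"
      by (subst measure_distr) (auto intro!: arg_cong[where f="measure _"])
    also have "\<dots> = measure ?N {z \<in> space ?N. z \<in> B'}"
      unfolding law
      by (subst measure_distr) (auto intro!: arg_cong[where f="measure _"] simp: T_mem)
    finally show ?thesis .
  qed
  have "event_variance P {\<omega> \<in> space P. D \<omega> \<in> B} Y =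
      (\<integral>\<omega>. indicator B (D \<omega>) * (\<beta> \<bullet> D \<omega>)\<^sup>2 \<partial>P) / measure P {\<omega> \<in> space P. D \<omega> \<in> B}
      + of_bool (measure P {\<omega> \<in> space P. D \<omega> \<in> B} \<noteq> 0) * P.variance E"
    by (intro event_variance_add_indep[OF P indep E2 B_meas _ L2 centred Y]) simp_all
  also have "(\<integral>\<omega>. indicator B (D \<omega>) * (\<beta> \<bullet> D \<omega>)\<^sup>2 \<partial>P) =
      (\<integral>z. indicator B' z * (\<Sum>k\<in>UNIV. ?w k * z k)\<^sup>2 \<partial>?N)"
    by (subst transfer) (simp_all only: BT \<beta>T, measurable)
  also have "\<dots> = (\<Sum>k\<in>UNIV. (?w k)\<^sup>2 * (\<integral>z. indicator B' z * (z k)\<^sup>2 \<partial>?N))"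
    unfolding B'_def by (rule truncated_second_moment_linear_form)
  \<comment> \<open>The square of \<open>?w k\<close> is \<open>lam k\<close> times the squared
    coordinate of \<open>transpose \<Gamma> *v \<beta>\<close>, and \<open>ridge_d\<close> is the
    truncated moment over the same probability.\<close>
  also have "\<dots> / measure P {\<omega> \<in> space P. D \<omega> \<in> B} =
      (\<Sum>k\<in>UNIV. lam k * ridge_d lam l t k * ((transpose \<Gamma> *v \<beta>) $ k)\<^sup>2)"
  proof -
    have "ridge_d lam l t k = (\<integral>z. indicator B' z * (z k)\<^sup>2 \<partial>?N) / measure P {\<omega> \<in> space P. D \<omega> \<in> B}" for k
    proof -
      have "ridge_d lam l t k = event_expectation ?N {z \<in> space ?N. z \<in> B'} (\<lambda>z. (z k)\<^sup>2)"
        by (simp add: ridge_d_def B'_def)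
      also have "\<dots> = (\<integral>z. indicator {z \<in> space ?N. z \<in> B'} z * (z k)\<^sup>2 \<partial>?N) / measure ?N {z \<in> space ?N. z \<in> B'}"
        by (intro event_expectation_eq prob_space_iid_normal) simp_all
      also have "(\<integral>z. indicator {z \<in> space ?N. z \<in> B'} z * (z k)\<^sup>2 \<partial>?N) = (\<integral>z. indicator B' z * (z k)\<^sup>2 \<partial>?N)"
        by (intro Bochner_Integration.integral_cong) (simp_all add: indicator_def)
      finally show ?thesis by (simp add: prob)
    qed
    then show ?thesis
      using lam[THEN less_imp_le]
      by (simp add: sum_divide_distrib power_mult_distrib mult_ac)
  qed
  finally show ?thesis by (simp add: A)
qed

theorem corollary4p2:
  fixes x :: "real^('k::{finite,linorder})^'n"
    and nT nC :: nat
    and S \<Gamma> :: "real^('k::{finite,linorder})^('k::{finite,linorder})"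
    and lam :: "'k \<Rightarrow> real"
    and Y :: "'n \<Rightarrow> bool \<Rightarrow> real"
    and \<beta>\<^sub>0 \<tau> :: real
    and \<beta> :: "real^('k::{finite,linorder})"
    and \<epsilon> :: "real^'n"
    and P :: "'a measure"
    and D :: "'a \<Rightarrow> real^('k::{finite,linorder})"
    and E tau_hat :: "'a \<Rightarrow> real"
    and l a al :: real
  assumes "nT \<ge> 1" and "nC \<ge> 1" and "nT + nC = CARD('n)"
    and "S = diff_cov x nT nC"
    and "pos_def S"
    and "orthogonal_matrix \<Gamma>"
    and "S = \<Gamma> ** diag_mat lam ** transpose \<Gamma>"
    and "antimono lam" and "\<And>k. lam k > 0"
    and "additive_effect x Y \<beta>\<^sub>0 \<beta> \<tau> \<epsilon>"
    and "prob_space P"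
    and "distributed P lborel D (mvn_density 0 S)"
    and "E \<in> borel_measurable P" and "integrable P (\<lambda>\<omega>. (E \<omega>)\<^sup>2)"
    and "indep_borel P D E"
    and "nT = nC"
    and "\<And>\<omega>. \<omega> \<in> space P \<Longrightarrow> tau_hat \<omega> = \<tau> + \<beta> \<bullet> D \<omega> + E \<omega>"
    and "l \<ge> 0" and "a > 0" and "al > 0"
    and "measure P {\<omega> \<in> space P. mahalanobis S (D \<omega>) \<le> a} =
         measure P {\<omega> \<in> space P. ridge_mahalanobis l S (D \<omega>) \<le> al}"
  shows "event_variance P {\<omega> \<in> space P. mahalanobis S (D \<omega>) \<le> a} tau_hat
       - event_variance P {\<omega> \<in> space P. ridge_mahalanobis l S (D \<omega>) \<le> al} tau_hat
       = \<beta> \<bullet> ((\<Gamma> ** diag_mat (\<lambda>k. lam k * (maha_v CARD('k) a - ridge_d lam l al k))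
                 ** transpose \<Gamma>) *v \<beta>)"
proof -
  \<comment> \<open>The premise \<open>0 \<le> l\<close> is left open, so that the fact serves ridge
    parameter \<open>0\<close> as well as \<open>l\<close>.\<close>
  note ridge = event_variance_ridge[OF assms(11,12,6,7,9) _ assms(15,14,17)]
  have maha_v: "maha_v CARD('k) a = ridge_d lam 0 a k" for k
  proof -
    have "lam j / (lam j + 0) = 1" for j
      using assms(9)[of j] by simp
    then show ?thesis
      by (simp add: maha_v_eq_truncated_moment[of a k] ridge_d_def)
  qed
  \<comment> \<open>The two probabilities agree, so both \<open>of_bool\<close> factors coincide and
    the variance of \<open>E\<close> cancels.\<close>
  have "event_variance P {\<omega> \<in> space P. mahalanobis S (D \<omega>) \<le> a} tau_hat
      - event_variance P {\<omega> \<in> space P. ridge_mahalanobis l S (D \<omega>) \<le> al} tau_hat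
      = (\<Sum>k\<in>UNIV. lam k * maha_v CARD('k) a * ((transpose \<Gamma> *v \<beta>) $ k)\<^sup>2)
      - (\<Sum>k\<in>UNIV. lam k * ridge_d lam l al k * ((transpose \<Gamma> *v \<beta>) $ k)\<^sup>2)"
    using assms(18,21) by (simp add: ridge mahalanobis_eq_ridge flip: maha_v)
  then show ?thesis
    by (simp add: inner_conjugated_diag_mat sum_subtractf algebra_simps)
qed

end
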